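(* Let $\Gamma$ be a group and $\rho$ a left-invariant metric on $\Gamma$ such that $B_\rho(e_\Gamma,r)=\{x\in\Gamma:\rho(x,e_\Gamma)\le r\}$ is finite for all $r\ge0$. Assume that $X$ is a Banach space whose modulus of uniform smoothness has power-type $p\in[1,2]$. Then $$\alpha_X^\#(\Gamma,\rho)\ \le\ \frac{1}{p\,\beta_p^*(\Gamma,\rho)}.$$
   Context: Smoothness: the modulus of uniform smoothness of a Banach space $X$ has power type $p$ if there is $c>0$ such that for every two unit vectors $x,y\in X$ and every $\tau>0$, $\|x+\tau y\|_X+\|x-\tau y\|_X\le 2+c\tau^p$. Equivariant compression: a map $\psi:\Gamma\to X$ is $\Gamma$-equivariant if there exist an action $\tau$ of $\Gamma$ on $X$ by affine isometries and a vector $v\in X$ with $\psi(x)=\tau(x)v$ for all $x\in\Gamma$. $\alpha_X^\#(\Gamma,\rho)$ is the supremum of those $\alpha\ge0$ for which there exist a $\rho$-Lipschitz $\Gamma$-equivariant map $\psi:\Gamma\to X$ and a constant $c>0$ with $\|\psi(x)-\psi(y)\|_X\ge c\,\rho(x,y)^\alpha$ for all $x,y\in\Gamma$ (the supremum of the empty set is read as $0$). The parameter $\beta_p^*$: a probability measure $\mu$ on $\Gamma$ is symmetric if $\mu(\{g\})=\mu(\{g^{-1}\})$ for all $g$. For such $\mu$ let $g_1,g_2,\dots$ be i.i.d. elements of $\Gamma$ with law $\mu$, and set $W_0^\mu=e_\Gamma$, $W_t^\mu=g_1g_2\cdots g_t$. For a sequence $\{\mu_t\}_{t=1}^\infty$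 of symmetric probability measures on $\Gamma$ put $$\beta_p^*\left(\{\mu_t\}_{t=1}^\infty,\rho\right)=\limsup_{t\to\infty}\frac{\log\left(\mathbb E_{\mu_t}\left[\rho(W_t^{\mu_t},e_\Gamma)\right]\right)}{\log\left(t\,\mathbb E_{\mu_t}\left[\rho(W_1^{\mu_t},e_\Gamma)^p\right]\right)}.$$ $\beta_p^*(\Gamma,\rho)$ is the supremum of $\beta_p^*(\{\mu_t\}_{t=1}^\infty,\rho)$ over all sequences of symmetric probability measures on $\Gamma$ with $\int_\Gamma\rho(x,e_\Gamma)^p\,d\mu_t(x)<\infty$ for all $t\in\mathbb N$ and $\lim_{t\to\infty}t\,\mu_t(\Gamma\setminus\{e_\Gamma\})=\infty$. Convention: $1/0=+\infty$. *)

theory Defs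
  imports "HOL-Probability.Probability" "HOL-Algebra.Group_Action"
begin

definition smoothness_power_type :: "'b::real_normed_vector itself \<Rightarrow> real \<Rightarrow> bool" where
  "smoothness_power_type X p \<longleftrightarrow>
     (\<exists>c>0. \<forall>(x::'b) (y::'b) t::real. norm x = 1 \<longrightarrow> norm y = 1 \<longrightarrow> t > 0 \<longrightarrow>
        norm (x + t *\<^sub>R y) + norm (x - t *\<^sub>R y) \<le> 2 + c * t powr p)"

definition affine_isometry :: "('b::real_normed_vector \<Rightarrow> 'b) \<Rightarrow> bool" where
  "affine_isometry T \<longleftrightarrow>
     (\<exists>A b. linear A \<and> (\<forall>x. T x = A x + b)) \<and> (\<forall>x y. dist (T x) (T y) = dist x y)"

definition equivariant_map :: "('a, 'm) monoid_scheme \<Rightarrow> ('a \<Rightarrow> 'b::real_normed_vector) \<Rightarrow> bool" where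
  "equivariant_map G \<psi> \<longleftrightarrow>
     (\<exists>\<tau> v. group_action G (UNIV :: 'b set) \<tau> \<and> (\<forall>g\<in>carrier G. affine_isometry (\<tau> g)) \<and>
            (\<forall>x\<in>carrier G. \<psi> x = \<tau> x v))"

(* Supremum in [-\<infinity>, \<infinity>], except that the supremum of the empty set is 0. *)
definition Sup0 :: "ereal set \<Rightarrow> ereal" where
  "Sup0 A = (if A = {} then 0 else Sup A)"

(* Since 0 powr 0 = 0, the lower bound is vacuous for x = y even when \<alpha> = 0.  The other
   convention 0^0 = 1 would only remove \<alpha> = 0 from the set, which does not change Sup0. *)
definition equivariant_compression ::
    "'b::banach itself \<Rightarrow> ('a, 'm) monoid_scheme \<Rightarrow> ('a \<Rightarrow> 'a \<Rightarrow> real) \<Rightarrow> ereal" where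
  "equivariant_compression X G \<rho> =
     Sup0 {ereal \<alpha> | \<alpha>. \<alpha> \<ge> 0 \<and>
       (\<exists>\<psi> :: 'a \<Rightarrow> 'b. equivariant_map G \<psi> \<and>
          (\<exists>L\<ge>0. \<forall>x\<in>carrier G. \<forall>y\<in>carrier G. norm (\<psi> x - \<psi> y) \<le> L * \<rho> x y) \<and>
          (\<exists>c>0. \<forall>x\<in>carrier G. \<forall>y\<in>carrier G. norm (\<psi> x - \<psi> y) \<ge> c * \<rho> x y powr \<alpha>))}"

(* Groups all of whose balls are finite are countable, so their probability measures are
   exactly the probability mass functions supported on the carrier. *)
definition symmetric_prob :: "('a, 'm) monoid_scheme \<Rightarrow> 'a pmf \<Rightarrow> bool" where
  "symmetric_prob G \<mu> \<longleftrightarrow>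
     set_pmf \<mu> \<subseteq> carrier G \<and> (\<forall>g\<in>carrier G. pmf \<mu> g = pmf \<mu> (inv\<^bsub>G\<^esub> g))"

(* Law of g_1 g_2 ... g_t for the list [g_1, ..., g_t] of t independent samples of \<mu>. *)
definition walk_pmf :: "('a, 'm) monoid_scheme \<Rightarrow> 'a pmf \<Rightarrow> nat \<Rightarrow> 'a pmf" where
  "walk_pmf G \<mu> t = map_pmf (\<lambda>gs. foldr (\<otimes>\<^bsub>G\<^esub>) gs \<one>\<^bsub>G\<^esub>) (replicate_pmf t \<mu>)"

(* Natural logarithm with log 0 = -\<infinity>; the expectation in the numerator of the quotient below
   can vanish, e.g. for even t if \<mu> is the point mass at an involution. *)
definition eln :: "real \<Rightarrow> ereal" where
  "eln x = (if x > 0 then ereal (ln x) else -\<infinity>)"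

definition beta_star_seq ::
    "('a, 'm) monoid_scheme \<Rightarrow> ('a \<Rightarrow> 'a \<Rightarrow> real) \<Rightarrow> real \<Rightarrow> (nat \<Rightarrow> 'a pmf) \<Rightarrow> ereal" where
  "beta_star_seq G \<rho> p \<mu> =
     limsup (\<lambda>t.
       eln (measure_pmf.expectation (walk_pmf G (\<mu> t) t) (\<lambda>x. \<rho> x \<one>\<^bsub>G\<^esub>)) /
       eln (real t * measure_pmf.expectation (walk_pmf G (\<mu> t) 1) (\<lambda>x. \<rho> x \<one>\<^bsub>G\<^esub> powr p)))"

(* Sequences are indexed by t \<ge> 1; the value \<mu> 0 is irrelevant. *)
definition admissible_seq ::
    "('a, 'm) monoid_scheme \<Rightarrow> ('a \<Rightarrow> 'a \<Rightarrow> real) \<Rightarrow> real \<Rightarrow> (nat \<Rightarrow> 'a pmf) \<Rightarrow> bool" where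
  "admissible_seq G \<rho> p \<mu> \<longleftrightarrow>
     (\<forall>t\<ge>1. symmetric_prob G (\<mu> t) \<and>
             integrable (measure_pmf (\<mu> t)) (\<lambda>x. \<rho> x \<one>\<^bsub>G\<^esub> powr p)) \<and>
     filterlim (\<lambda>t. real t * measure_pmf.prob (\<mu> t) (carrier G - {\<one>\<^bsub>G\<^esub>})) at_top sequentially"

(* There are admissible sequences unless G is trivial.  For trivial G the supremum is read as 0,
   as for the compression exponent. *)
definition beta_star ::
    "('a, 'm) monoid_scheme \<Rightarrow> ('a \<Rightarrow> 'a \<Rightarrow> real) \<Rightarrow> real \<Rightarrow> ereal" where
  "beta_star G \<rho> p = Sup0 {beta_star_seq G \<rho> p \<mu> | \<mu>. admissible_seq G \<rho> p \<mu>}"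

end

theory Submission
  imports Defs
begin

text \<open>
  Let \<open>\<psi>\<close> be an equivariant Lipschitz map with compression exponent \<open>\<alpha>\<close>. Then \<open>b g = \<psi> g - \<psi> \<one>\<close> is a cocycle
  for an isometric linear representation \<open>\<pi>\<close>, that is, \<open>b (g \<otimes> h) = b g + \<pi> g (b h)\<close>. The theorem rests
  on the fact that in a \<open>p\<close>-smooth Banach space the \<open>p\<close>-th moment of \<open>b\<close> along a symmetric random walk
  \<open>W\<^sub>t\<close> grows at most linearly: it is at most a constant times \<open>t\<close> times the \<open>p\<close>-th moment of \<open>b\<close> over one
  step (\<open>moment_cocycle\<close>). With the compression bound below and the Lipschitz bound above, the mean
  of \<open>\<rho> W\<^sub>t \<one> powr (p * \<alpha>)\<close> is at most a constant times \<open>t\<close> times the \<open>p\<close>-th moment of the step length. Jensen's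
  inequality turns this into a bound for the mean of \<open>\<rho> W\<^sub>t \<one>\<close>, and after taking logarithms the
  displacement exponent is at most \<open>1 / (p * \<alpha>)\<close>.

  The linear growth is proved as for Markov type. If \<open>b\<close> had mean zero, \<open>b W\<^sub>t\<close> would be a martingale, and
  smoothness would bound the effect of each step (\<open>smooth_increment\<close>). The mean \<open>m\<close> need not vanish,
  but the walk can also be read backwards, and its steps have the same law by symmetry. The
  sum of the two expansions of \<open>b W\<^sub>t\<close> consists of two martingales, up to an isometry, and a drift
  that telescopes to \<open>m - \<pi> W\<^sub>t m\<close> (\<open>forward_backward_decomposition\<close>).

  Two boundary cases need separate arguments. For \<open>p * \<alpha> < 1\<close> the displacement exponent is at most \<open>1\<close> by
  the triangle inequality (\<open>moment_growth_1\<close>). And \<open>beta_star\<close> is nonnegative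
  (\<open>beta_star_nonneg\<close>), so that the right side of the theorem is a nonnegative number or \<open>\<infinity>\<close>.
\<close>

section \<open>Powers of real numbers\<close>

lemma powr_le_Bernoulli:
  fixes y s :: real
  assumes "0 \<le> y" "0 \<le> s" "s \<le> 1"
  shows "y powr s \<le> 1 + s * (y - 1)"
proof (cases "y = 0")
  case False
  then show ?thesis
    using Youngs_inequality_0[of s "1 - s" y 1] assms by (simp add: algebra_simps)
qed (use assms in simp)

lemma powr_ge_Bernoulli:
  fixes y q :: real
  assumes "0 \<le> y" "1 \<le> q"
  shows "1 + q * (y - 1) \<le> y powr q"
proof -
  have "(y powr q) powr (1 / q) \<le> 1 + (1 / q) * (y powr q - 1)"
    using assms by (intro powr_le_Bernoulli) auto
  moreover have "(y powr q) powr (1 / q) = y"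
    using assms by (simp add: powr_powr)
  ultimately have "q * y \<le> q * (1 + (1 / q) * (y powr q - 1))"
    using assms by (intro mult_left_mono) auto
  then show ?thesis
    using assms by (simp add: algebra_simps)
qed

text \<open>The convexity of the power function, in the form that yields Jensen's inequality. The
  convention \<open>0 powr a = 0\<close> makes the tangent line at \<open>r = 0\<close> the zero function, also for \<open>q = 1\<close>.\<close>

lemma powr_tangent_line:
  fixes y r q :: real
  assumes "0 \<le> y" "0 \<le> r" "1 \<le> q"
  shows "r powr q + q * r powr (q - 1) * (y - r) \<le> y powr q"
proof (cases "r = 0")
  case False
  then have "r > 0" using assms by simp
  have "r powr q * (1 + q * (y / r - 1)) \<le> r powr q * (y / r) powr q"
    using assms by (intro mult_left_mono powr_ge_Bernoulli) auto
  also have "r powr q * (y / r) powr q = y powr q"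
    using assms \<open>r > 0\<close> by (simp flip: powr_mult)
  also have "r powr q * (1 + q * (y / r - 1)) = r powr q + q * r powr (q - 1) * (y - r)"
    using \<open>r > 0\<close> by (simp add: powr_diff field_simps)
  finally show ?thesis .
qed simp

text \<open>Split off one factor \<open>1 + u\<close>; the remaining exponent \<open>p - 1\<close> lies in \<open>[0, 1]\<close>, where the power is
  concave and lies below its tangent line at \<open>1\<close>.\<close>

lemma powr_expansion:
  fixes u p :: real
  assumes "-1 \<le> u" "1 \<le> p" "p \<le> 2"
  shows "(1 + u) powr p \<le> 1 + p * u + u\<^sup>2"
proof -
  have "(1 + u) powr p = (1 + u) powr (p - 1) * (1 + u)"
    using assms powr_mult_base[of "1 + u" "p - 1"] by (simp add: mult.commute)
  also have "\<dots> \<le> (1 + (p - 1) * ((1 + u) - 1)) * (1 + u)"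
    using assms by (intro mult_right_mono powr_le_Bernoulli) auto
  also have "\<dots> = 1 + p * u + (p - 1) * u\<^sup>2"
    by (simp add: algebra_simps power2_eq_square)
  also have "\<dots> \<le> 1 + p * u + 1 * u\<^sup>2"
    using assms by (intro add_left_mono mult_right_mono) auto
  finally show ?thesis by simp
qed

lemma powr_le_square:
  fixes x p :: real
  assumes "1 \<le> x" "p \<le> 2"
  shows "x powr p \<le> x\<^sup>2"
  using powr_mono[of p 2 x] assms by simp

lemma powr_add_le:
  fixes x y p :: real
  assumes "0 \<le> x" "0 \<le> y" "1 \<le> p" "p \<le> 2"
  shows "(x + y) powr p \<le> 4 * (x powr p + y powr p)"
proof -
  have "(x + y) powr p \<le> (2 * max x y) powr p"
    using assms by (intro powr_mono2) auto
  also have "\<dots> = 2 powr p * max x y powr p"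
    using assms by (simp add: powr_mult)
  also have "\<dots> \<le> 4 * max x y powr p"
    using powr_le_square[of 2 p] assms by (intro mult_right_mono) auto
  also have "\<dots> \<le> 4 * (x powr p + y powr p)"
    by (auto simp: max_def)
  finally show ?thesis .
qed

section \<open>Uniform smoothness as a two-point inequality\<close>

text \<open>The homogeneous form of uniform smoothness: it speaks of all vectors and of \<open>p\<close>-th powers of
  norms, and therefore can be averaged over a random \<open>y\<close>.\<close>

definition two_point_smooth :: "'b::real_normed_vector itself \<Rightarrow> real \<Rightarrow> real \<Rightarrow> bool" where
  "two_point_smooth X p K \<longleftrightarrow> K \<ge> 0 \<and>
     (\<forall>(x::'b) y. norm (x + y) powr p + norm (x - y) powr p
                    \<le> 2 * norm x powr p + K * norm y powr p)"

text \<open>By homogeneity \<open>x\<close> may be taken to be a unit vector. If \<open>norm y \<ge> 1\<close>, then \<open>norm y powr p\<close> alone dominates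
  the left side. Otherwise \<open>norm (x + y) = 1 + u\<close> and \<open>norm (x - y) = 1 + v\<close> with small \<open>u\<close> and \<open>v\<close>;
  smoothness bounds \<open>u + v\<close>, hence the first-order terms of the two \<open>p\<close>-th powers, and the
  second-order terms are at most \<open>(norm y)\<^sup>2 \<le> norm y powr p\<close>.\<close>

lemma smoothness_imp_two_point:
  assumes p: "1 \<le> p" "p \<le> 2" and "smoothness_power_type TYPE('b::real_normed_vector) p"
  obtains K where "two_point_smooth TYPE('b) p K"
proof -
  obtain c where c: "c > 0" and smooth: "\<And>(x::'b) y t. norm x = 1 \<Longrightarrow> norm y = 1 \<Longrightarrow> t > 0 \<Longrightarrow>
      norm (x + t *\<^sub>R y) + norm (x - t *\<^sub>R y) \<le> 2 + c * t powr p"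
    using assms(3) unfolding smoothness_power_type_def by blast
  \<comment> \<open>\<open>8\<close> suffices for \<open>norm y \<ge> 1\<close>, \<open>2 * c + 2\<close> for smaller \<open>y\<close>, and \<open>2\<close> for \<open>x = 0\<close>.\<close>
  define K where "K = 2 * c + 8"
  have unit: "norm (x + y) powr p + norm (x - y) powr p \<le> 2 + K * norm y powr p"
    if x: "norm x = 1" and "y \<noteq> 0" for x y :: 'b
  proof -
    define t where "t = norm y"
    have t: "t > 0" using \<open>y \<noteq> 0\<close> by (simp add: t_def)
    have ab: "norm (x + y) + norm (x - y) \<le> 2 + c * t powr p"
      using smooth[of x "y /\<^sub>R t" t] x t by (simp add: t_def)
    have bounds: "\<bar>norm (x + y) - 1\<bar> \<le> t" "\<bar>norm (x - y) - 1\<bar> \<le> t"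
      using norm_triangle_ineq3[of "x + y" x] norm_triangle_ineq3[of "x - y" x] x
      by (simp_all add: t_def)
    have tp: "t powr p \<ge> 0" by simp
    show ?thesis
    proof (cases "t \<ge> 1")
      case True
      have "norm z powr p \<le> 4 * t powr p" if "\<bar>norm z - 1\<bar> \<le> t" for z :: 'b
      proof -
        have "norm z powr p \<le> (2 * t) powr p"
          using that True p by (intro powr_mono2) auto
        also have "\<dots> = 2 powr p * t powr p"
          using t by (simp add: powr_mult)
        also have "\<dots> \<le> 4 * t powr p"
          using powr_le_square[of 2 p] p by (intro mult_right_mono) auto
        finally show ?thesis .
      qed
      from this[OF bounds(1)] this[OF bounds(2)]
      have "norm (x + y) powr p + norm (x - y) powr p \<le> 8 * t powr p" by simp
      also have "\<dots> \<le> 2 + K * t powr p"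
        using c tp by (simp add: K_def algebra_simps)
      finally show ?thesis by (simp add: t_def)
    next
      case False
      have t2: "t\<^sup>2 \<le> t powr p"
        using powr_mono'[of p 2 t] False t p by simp
      have u2: "u\<^sup>2 \<le> t\<^sup>2" if "\<bar>u\<bar> \<le> t" for u
        using that t by (simp add: abs_le_square_iff[symmetric])
      define u v where "u = norm (x + y) - 1" and "v = norm (x - y) - 1"
      have "(1 + u) powr p + (1 + v) powr p \<le> (1 + p * u + u\<^sup>2) + (1 + p * v + v\<^sup>2)"
        using p by (intro add_mono powr_expansion) (auto simp: u_def v_def)
      also have "\<dots> = 2 + p * (u + v) + u\<^sup>2 + v\<^sup>2" by (simp add: algebra_simps)
      also have "\<dots> \<le> 2 + p * (c * t powr p) + t powr p + t powr p"
        using ab bounds u2[of u] u2[of v] t2 p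
        by (intro add_mono mult_left_mono) (auto simp: u_def v_def)
      also have "\<dots> \<le> 2 + 2 * (c * t powr p) + t powr p + t powr p"
        using p c by (intro add_mono mult_right_mono) auto
      also have "\<dots> \<le> 2 + K * t powr p"
        using tp by (simp add: K_def algebra_simps)
      finally show ?thesis by (simp add: t_def u_def v_def)
    qed
  qed
  have "norm (x + y) powr p + norm (x - y) powr p \<le> 2 * norm x powr p + K * norm y powr p"
    for x y :: 'b
  proof (cases "x = 0 \<or> y = 0")
    case True
    then show ?thesis
    proof (elim disjE)
      assume "x = 0"
      have "2 * norm y powr p \<le> K * norm y powr p"
        using c by (intro mult_right_mono) (auto simp: K_def)
      then show ?thesis using \<open>x = 0\<close> p by simp
    qed simp
  next
    case False
    define r where "r = norm x"
    have r: "r > 0" using False by (simp add: r_def)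
    have scale: "r powr p * norm z powr p = norm (r *\<^sub>R z) powr p" for z :: 'b
      using r by (simp add: powr_mult)
    have "r powr p * (norm (x /\<^sub>R r + y /\<^sub>R r) powr p + norm (x /\<^sub>R r - y /\<^sub>R r) powr p)
            \<le> r powr p * (2 + K * norm (y /\<^sub>R r) powr p)"
      using False r by (intro mult_left_mono unit) (auto simp: r_def)
    also have "\<dots> = 2 * r powr p + K * (r powr p * norm (y /\<^sub>R r) powr p)"
      by (simp add: algebra_simps)
    finally show ?thesis
      unfolding distrib_left scale using r by (simp add: scaleR_add_right scaleR_diff_right r_def)
  qed
  then show thesis
    using that[of K] c by (auto simp: two_point_smooth_def K_def)
qed

section \<open>Means of Banach space valued functions\<close>

text \<open>The Banach space may be nonseparable, so the mean is the unordered sum over the atoms rather than an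
  integral of a function with values in a separable space.\<close>

definition pmf_mean :: "'a pmf \<Rightarrow> ('a \<Rightarrow> 'b::real_normed_vector) \<Rightarrow> 'b" where
  "pmf_mean \<mu> f = (\<Sum>\<^sub>\<infinity>g. pmf \<mu> g *\<^sub>R f g)"

text \<open>Real expectations are written as unordered sums in order to compare them with \<^const>\<open>pmf_mean\<close>.\<close>

lemma has_sum_expectation:
  fixes h :: "'a \<Rightarrow> real"
  assumes "integrable (measure_pmf \<mu>) h"
  shows "((\<lambda>g. pmf \<mu> g * h g) has_sum measure_pmf.expectation \<mu> h) UNIV"
proof -
  have int: "integrable (count_space UNIV) (\<lambda>g. pmf \<mu> g * h g)"
    using assms by (simp add: measure_pmf_eq_density integrable_density)
  then have abs: "Infinite_Set_Sum.abs_summable_on (\<lambda>g. pmf \<mu> g * h g) UNIV"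
    by (simp add: Infinite_Set_Sum.abs_summable_on_def)
  have "measure_pmf.expectation \<mu> h = infsetsum (\<lambda>g. pmf \<mu> g * h g) UNIV"
    unfolding infsetsum_def measure_pmf_eq_density by (subst integral_density) simp_all
  also have "\<dots> = (\<Sum>\<^sub>\<infinity>g. pmf \<mu> g * h g)"
    by (rule infsetsum_infsum[OF abs])
  finally have "measure_pmf.expectation \<mu> h = (\<Sum>\<^sub>\<infinity>g. pmf \<mu> g * h g)" .
  moreover have "(\<lambda>g. pmf \<mu> g * h g) summable_on UNIV"
    by (rule abs_summable_summable[OF abs_summable_equivalent[THEN iffD2, OF abs]])
  ultimately show ?thesis
    by (simp add: has_sum_infsum)
qed

text \<open>Since the weights of \<open>\<mu>\<close> add up to \<open>1\<close>, the vector \<open>c - pmf_mean \<mu> f\<close> is the mean of \<open>c - f\<close>, and the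
  triangle inequality for absolutely convergent sums applies.\<close>

lemma norm_diff_pmf_mean_le:
  fixes f :: "'a \<Rightarrow> 'b::banach"
  assumes int: "integrable (measure_pmf \<mu>) (\<lambda>g. norm (f g))"
  shows "norm (c - pmf_mean \<mu> f) \<le> measure_pmf.expectation \<mu> (\<lambda>g. norm (c - f g))"
proof -
  have abs_summable: "(\<lambda>g. norm (pmf \<mu> g *\<^sub>R h g)) summable_on UNIV"
    if "integrable (measure_pmf \<mu>) (\<lambda>g. norm (h g))" for h :: "'a \<Rightarrow> 'b"
    using has_sum_expectation[OF that] by (auto simp: summable_on_def)
  have "(pmf \<mu> has_sum 1) UNIV"
    using has_sum_expectation[of \<mu> "\<lambda>_. 1"] by simp
  from has_sum_bounded_linear[OF bounded_linear_scaleR_left[of c] this]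
  have const: "((\<lambda>g. pmf \<mu> g *\<^sub>R c) has_sum c) UNIV"
    by simp
  have "((\<lambda>g. pmf \<mu> g *\<^sub>R f g) has_sum pmf_mean \<mu> f) UNIV"
    unfolding pmf_mean_def by (rule has_sum_infsum[OF abs_summable_summable[OF abs_summable[OF int]]])
  from has_sum_add[OF const has_sum_scaleR[OF this, of "-1"]]
  have mean: "((\<lambda>g. pmf \<mu> g *\<^sub>R (c - f g)) has_sum (c - pmf_mean \<mu> f)) UNIV"
    by (simp add: scaleR_diff_right)
  have int': "integrable (measure_pmf \<mu>) (\<lambda>g. norm (c - f g))"
    by (rule Bochner_Integration.integrable_bound[of _ "\<lambda>g. norm c + norm (f g)"])
      (use int in \<open>auto intro: norm_triangle_ineq4\<close>)
  have "norm (\<Sum>\<^sub>\<infinity>g. pmf \<mu> g *\<^sub>R (c - f g)) \<le> (\<Sum>\<^sub>\<infinity>g. norm (pmf \<mu> g *\<^sub>R (c - f g)))"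
    by (intro norm_infsum_bound abs_summable int')
  also have "\<dots> = measure_pmf.expectation \<mu> (\<lambda>g. norm (c - f g))"
    using infsumI[OF has_sum_expectation[OF int']] by simp
  finally show ?thesis
    using infsumI[OF mean] by simp
qed

text \<open>Integrate the tangent line at the mean. If \<open>f\<close> is not integrable, the left side is \<open>0\<close> by the
  convention for integrals; if its \<open>q\<close>-th power is not, the right side is infinite.\<close>

lemma Jensen_powr:
  fixes f :: "'a \<Rightarrow> real"
  assumes f: "\<And>x. 0 \<le> f x" and q: "1 \<le> q"
  shows "ennreal (measure_pmf.expectation \<mu> f powr q) \<le> (\<integral>\<^sup>+x. ennreal (f x powr q) \<partial>measure_pmf \<mu>)"
proof (cases "integrable (measure_pmf \<mu>) f \<and> (\<integral>\<^sup>+x. ennreal (f x powr q) \<partial>measure_pmf \<mu>) \<noteq> \<infinity>")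
  case True
  define r where "r = measure_pmf.expectation \<mu> f"
  have r: "r \<ge> 0" unfolding r_def by (intro integral_nonneg_AE) (auto simp: f)
  have int: "integrable (measure_pmf \<mu>) (\<lambda>x. f x powr q)"
    using True by (intro integrableI_nonneg) (auto simp: top.not_eq_extremum)
  have intf: "integrable (measure_pmf \<mu>) f" using True by simp
  have "r powr q = measure_pmf.expectation \<mu> (\<lambda>x. r powr q + q * r powr (q - 1) * (f x - r))"
    using intf by (simp add: r_def)
  also have "\<dots> \<le> measure_pmf.expectation \<mu> (\<lambda>x. f x powr q)"
    using intf int by (intro integral_mono powr_tangent_line f r q) auto
  finally show ?thesis
    using int by (simp add: nn_integral_eq_integral r_def ennreal_leI)
next
  case False
  then show ?thesis
    using q by (auto simp: not_integrable_integral_eq)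
qed

lemma integrable_norm_if_moment:
  fixes f :: "'a \<Rightarrow> 'b::real_normed_vector"
  assumes "1 \<le> p" "(\<integral>\<^sup>+g. ennreal (norm (f g) powr p) \<partial>measure_pmf \<mu>) < \<infinity>"
  shows "integrable (measure_pmf \<mu>) (\<lambda>g. norm (f g))"
proof -
  have le: "norm (f g) \<le> 1 + norm (f g) powr p" for g
  proof (cases "norm (f g) \<le> 1")
    case False
    then show ?thesis using powr_mono[of 1 p "norm (f g)"] assms(1) by simp
  qed (smt (verit) powr_ge_zero)
  have "integrable (measure_pmf \<mu>) (\<lambda>g. norm (f g) powr p)"
    using assms by (intro integrableI_nonneg) auto
  then have "integrable (measure_pmf \<mu>) (\<lambda>g. 1 + norm (f g) powr p)"
    by simp
  then show ?thesis
    by (rule Bochner_Integration.integrable_bound) (simp_all add: le AE_I2)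
qed

lemma norm_diff_pmf_mean_powr_le:
  fixes f :: "'a \<Rightarrow> 'b::banach"
  assumes p: "1 \<le> p" and fin: "(\<integral>\<^sup>+g. ennreal (norm (f g) powr p) \<partial>measure_pmf \<mu>) < \<infinity>"
  shows "ennreal (norm (c - pmf_mean \<mu> f) powr p)
           \<le> (\<integral>\<^sup>+g. ennreal (norm (c - f g) powr p) \<partial>measure_pmf \<mu>)"
proof -
  have "norm (c - pmf_mean \<mu> f) powr p \<le> measure_pmf.expectation \<mu> (\<lambda>g. norm (c - f g)) powr p"
    using p norm_diff_pmf_mean_le[OF integrable_norm_if_moment[OF p fin]] by (intro powr_mono2) auto
  from order_trans[OF ennreal_leI[OF this] Jensen_powr] show ?thesis
    using p by simp
qed

text \<open>This is the step in Pisier's martingale inequality: a centred increment adds at most a multiple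
  of its own \<open>p\<close>-th moment. Average the two-point inequality over the increment \<open>y\<close>. Of the two terms
  on its left side, the one with \<open>x - y\<close> has mean at least \<open>norm x powr p\<close> by Jensen's inequality,
  because \<open>y\<close> has mean zero; it cancels one of the two copies of \<open>norm x powr p\<close> on the right.\<close>

lemma smooth_increment:
  fixes f :: "'a \<Rightarrow> 'b::banach"
  assumes p: "1 \<le> p" and fin: "(\<integral>\<^sup>+g. ennreal (norm (f g) powr p) \<partial>measure_pmf \<mu>) < \<infinity>"
    and smooth: "two_point_smooth TYPE('b) p K"
  shows "(\<integral>\<^sup>+g. ennreal (norm (x + (f g - pmf_mean \<mu> f)) powr p) \<partial>measure_pmf \<mu>)
           \<le> ennreal (norm x powr p)
              + ennreal K * (\<integral>\<^sup>+g. ennreal (norm (f g - pmf_mean \<mu> f) powr p) \<partial>measure_pmf \<mu>)"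
    (is "?A \<le> ?X + ?V")
proof -
  define m where "m = pmf_mean \<mu> f"
  define B where "B = (\<integral>\<^sup>+g. ennreal (norm (x - (f g - m)) powr p) \<partial>measure_pmf \<mu>)"
  have K: "K \<ge> 0" using smooth by (simp add: two_point_smooth_def)
  have "?X \<le> B"
    using norm_diff_pmf_mean_powr_le[OF p fin, of "x + m"] by (simp add: B_def m_def algebra_simps)
  \<comment> \<open>\<open>B\<close> is the term of the reflected increment.\<close>
  have two_sided: "?A + B \<le> ?X + (?X + ?V)"
  proof -
    have "?A + B = (\<integral>\<^sup>+g. ennreal (norm (x + (f g - m)) powr p + norm (x - (f g - m)) powr p) \<partial>measure_pmf \<mu>)"
      unfolding B_def m_def by (subst nn_integral_add[symmetric]) simp_all
    also have "\<dots> \<le> (\<integral>\<^sup>+g. ennreal (2 * norm x powr p + K * norm (f g - m) powr p) \<partial>measure_pmf \<mu>)"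
      using smooth by (intro nn_integral_mono ennreal_leI) (auto simp: two_point_smooth_def)
    also have "\<dots> = (\<integral>\<^sup>+g. ennreal (2 * norm x powr p) + ennreal K * ennreal (norm (f g - m) powr p) \<partial>measure_pmf \<mu>)"
      using K by (intro nn_integral_cong) (simp add: ennreal_mult)
    also have "\<dots> = ennreal (2 * norm x powr p) + ?V"
      unfolding m_def by (subst nn_integral_add) (simp_all add: nn_integral_cmult)
    also have "ennreal (2 * norm x powr p) = ?X + ?X"
      by (subst ennreal_plus[symmetric]) simp_all
    finally show ?thesis by (simp add: add.assoc)
  qed
  have "?X + ?A \<le> B + ?A"
    by (intro add_right_mono \<open>?X \<le> B\<close>)
  also have "\<dots> \<le> ?X + (?X + ?V)"
    using two_sided unfolding add.commute[of B] .
  finally show ?thesis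
    unfolding ennreal_add_left_cancel_le by simp
qed

section \<open>Random walks and cocycles\<close>

text \<open>A new step can be inserted at the front or at the end of the sequence of steps. The two martingales
  below need one form each.\<close>

lemma nn_integral_replicate_pmf_Cons:
  "(\<integral>\<^sup>+gs. F gs \<partial>replicate_pmf (Suc t) \<mu>) = (\<integral>\<^sup>+gs. \<integral>\<^sup>+g. F (g # gs) \<partial>\<mu> \<partial>replicate_pmf t \<mu>)"
proof -
  have "replicate_pmf (Suc t) \<mu>
      = bind_pmf (replicate_pmf t \<mu>) (\<lambda>gs. bind_pmf \<mu> (\<lambda>g. return_pmf (g # gs)))"
    by (simp add: bind_commute_pmf[of \<mu>])
  then show ?thesis by (simp del: replicate_pmf.simps)
qed

lemma nn_integral_replicate_pmf_snoc:
  "(\<integral>\<^sup>+gs. F gs \<partial>replicate_pmf (Suc t) \<mu>) = (\<integral>\<^sup>+gs. \<integral>\<^sup>+g. F (gs @ [g]) \<partial>\<mu> \<partial>replicate_pmf t \<mu>)"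
proof -
  have "replicate_pmf (Suc t) \<mu> = replicate_pmf (t + 1) \<mu>"
    by (simp only: Suc_eq_plus1)
  also have "\<dots> = bind_pmf (replicate_pmf t \<mu>) (\<lambda>gs. bind_pmf \<mu> (\<lambda>g. return_pmf (gs @ [g])))"
    unfolding replicate_pmf_distrib replicate_pmf_1 by (simp add: bind_map_pmf)
  finally show ?thesis by (simp del: replicate_pmf.simps)
qed

lemma nn_integral_replicate_pmf_mono:
  assumes "set_pmf \<mu> \<subseteq> A" "\<And>gs. set gs \<subseteq> A \<Longrightarrow> F gs \<le> H gs"
  shows "(\<integral>\<^sup>+gs. F gs \<partial>replicate_pmf t \<mu>) \<le> (\<integral>\<^sup>+gs. H gs \<partial>replicate_pmf t \<mu>)"
  using assms by (intro nn_integral_mono_AE) (auto simp: AE_measure_pmf_iff set_replicate_pmf)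

abbreviation (in group) word_prod :: "'a list \<Rightarrow> 'a" where
  "word_prod gs \<equiv> foldr (\<otimes>) gs \<one>"

lemma (in group) word_prod_closed [simp]:
  "set gs \<subseteq> carrier G \<Longrightarrow> word_prod gs \<in> carrier G"
  by (induction gs) auto

lemma (in group) map_pmf_inv_symmetric:
  assumes "symmetric_prob G \<mu>"
  shows "map_pmf (\<lambda>g. inv g) \<mu> = \<mu>"
proof (rule pmf_eqI)
  fix x
  have sub: "set_pmf \<mu> \<subseteq> carrier G" and sym: "\<And>g. g \<in> carrier G \<Longrightarrow> pmf \<mu> g = pmf \<mu> (inv g)"
    using assms unfolding symmetric_prob_def by blast+
  have "pmf (map_pmf (\<lambda>g. inv g) \<mu>) x
      = measure_pmf.prob \<mu> (((\<lambda>g. inv g) -` {x}) \<inter> set_pmf \<mu>)"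
    by (simp add: pmf_map measure_Int_set_pmf)
  also have "\<dots> = pmf \<mu> x"
  proof (cases "x \<in> carrier G")
    case True
    then have "((\<lambda>g. inv g) -` {x}) \<inter> set_pmf \<mu> = {inv x} \<inter> set_pmf \<mu>"
      using sub by auto
    then show ?thesis
      using sym[OF True] by (simp add: measure_Int_set_pmf measure_pmf_single)
  next
    case False
    then have "((\<lambda>g. inv g) -` {x}) \<inter> set_pmf \<mu> = {}"
      using sub by auto
    moreover have "x \<notin> set_pmf \<mu>" using sub False by auto
    ultimately show ?thesis by (simp add: set_pmf_iff)
  qed
  finally show "pmf (map_pmf (\<lambda>g. inv g) \<mu>) x = pmf \<mu> x" .
qed

text \<open>The data of an action by affine isometries: \<open>\<pi>\<close> is its linear part, and \<open>b g\<close> is the displacement of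
  the base point under \<open>g\<close>.\<close>

locale isometric_cocycle = group G for G :: "('a, 'm) monoid_scheme" (structure) +
  fixes \<pi> :: "'a \<Rightarrow> 'b::banach \<Rightarrow> 'b" and b :: "'a \<Rightarrow> 'b"
  assumes linear_\<pi>: "g \<in> carrier G \<Longrightarrow> linear (\<pi> g)"
    and norm_\<pi>: "g \<in> carrier G \<Longrightarrow> norm (\<pi> g x) = norm x"
    and \<pi>_mult: "g \<in> carrier G \<Longrightarrow> h \<in> carrier G \<Longrightarrow> \<pi> (g \<otimes> h) x = \<pi> g (\<pi> h x)"
    and \<pi>_one: "\<pi> \<one> x = x"
    and cocycle: "g \<in> carrier G \<Longrightarrow> h \<in> carrier G \<Longrightarrow> b (g \<otimes> h) = b g + \<pi> g (b h)"
begin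

lemmas \<pi>_add = linear_add[OF linear_\<pi>]
  and \<pi>_diff = linear_diff[OF linear_\<pi>]
  and \<pi>_0 = linear_0[OF linear_\<pi>]
  and \<pi>_scaleR = linear_cmul[OF linear_\<pi>]

lemma b_one: "b \<one> = 0"
  using cocycle[of \<one> \<one>] by (simp add: \<pi>_one)

lemma \<pi>_inv: "g \<in> carrier G \<Longrightarrow> \<pi> (inv g) (\<pi> g x) = x"
  using \<pi>_mult[of "inv g" g x] by (simp add: \<pi>_one)

lemma \<pi>_inv': "g \<in> carrier G \<Longrightarrow> \<pi> g (\<pi> (inv g) x) = x"
  using \<pi>_mult[of g "inv g" x] by (simp add: \<pi>_one)

lemma \<pi>_b_inv: "g \<in> carrier G \<Longrightarrow> \<pi> g (b (inv g)) = - b g"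
  using cocycle[of g "inv g"] by (simp add: b_one eq_neg_iff_add_eq_0 add.commute)

lemma norm_add_\<pi>: "g \<in> carrier G \<Longrightarrow> norm (x + \<pi> g y) = norm (\<pi> (inv g) x + y)"
  using norm_\<pi>[of "inv g" "x + \<pi> g y"] by (simp add: \<pi>_add \<pi>_inv)

text \<open>For independent steps \<open>g\<^sub>1, \<dots>, g\<^sub>t\<close> and \<open>w\<^sub>i = g\<^sub>1 \<cdots> g\<^sub>i\<close>, the sum of the vectors
  \<open>\<pi> w\<^sub>i\<^sub>-\<^sub>1 (b g\<^sub>i - m)\<close> is a martingale in \<open>t\<close> if \<open>m\<close> is the mean of \<open>b\<close>. It is given by recursion on
  the first step, which suits the cocycle identity; \<open>forward_sum_snoc\<close> exhibits the increments.\<close>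

primrec forward_sum :: "'b \<Rightarrow> 'a list \<Rightarrow> 'b" where
  "forward_sum m [] = 0"
| "forward_sum m (g # gs) = (b g - m) + \<pi> g (forward_sum m gs)"

text \<open>The corresponding sum for the reversed walk with steps \<open>inv g\<^sub>t, \<dots>, inv g\<^sub>1\<close>. Here a new first step
  of the original walk is the last step of the reversed one, so the recursion shows the
  martingale increments directly.\<close>

primrec backward_sum :: "'b \<Rightarrow> 'a list \<Rightarrow> 'b" where
  "backward_sum m [] = 0"
| "backward_sum m (g # gs) = backward_sum m gs + \<pi> (inv (word_prod gs)) (b (inv g) - m)"

lemma forward_sum_snoc:
  assumes "set gs \<subseteq> carrier G" "g \<in> carrier G"
  shows "forward_sum m (gs @ [g]) = forward_sum m gs + \<pi> (word_prod gs) (b g - m)"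
  using assms by (induction gs) (auto simp: \<pi>_one \<pi>_0 \<pi>_add \<pi>_mult)

text \<open>Expanding \<open>b (word_prod gs)\<close> along the walk gives the forward sum plus the drift, the sum of the
  \<open>\<pi> w\<^sub>i\<^sub>-\<^sub>1 m\<close>. Expanding it from the other end, by \<open>b g = - \<pi> g (b (inv g))\<close>, gives minus the image of the
  backward sum, and the drift with terms \<open>- \<pi> w\<^sub>i m\<close>. Neither drift need be small, but their sum
  telescopes to \<open>m - \<pi> (word_prod gs) m\<close>.\<close>

lemma forward_backward_decomposition:
  assumes "set gs \<subseteq> carrier G"
  shows "2 *\<^sub>R b (word_prod gs) = forward_sum m gs - \<pi> (word_prod gs) (backward_sum m gs)
           + (m - \<pi> (word_prod gs) m)"
  using assms
proof (induction gs)
  case Nil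
  then show ?case by (simp add: b_one \<pi>_one)
next
  case (Cons g gs)
  define w where "w = word_prod gs"
  have g: "g \<in> carrier G" and w: "w \<in> carrier G" using Cons by (auto simp: w_def)
  have "2 *\<^sub>R b (g \<otimes> w) = 2 *\<^sub>R b g + \<pi> g (2 *\<^sub>R b w)"
    using g w by (simp add: cocycle \<pi>_scaleR scaleR_add_right)
  also have "2 *\<^sub>R b w = forward_sum m gs - \<pi> w (backward_sum m gs) + (m - \<pi> w m)"
    using Cons by (simp add: w_def)
  also have "2 *\<^sub>R b g + \<pi> g \<dots> = (b g - m + \<pi> g (forward_sum m gs))
      - (\<pi> (g \<otimes> w) (backward_sum m gs) + \<pi> g (b (inv g) - m)) + (m - \<pi> (g \<otimes> w) m)"
    using g w by (simp add: \<pi>_add \<pi>_diff \<pi>_mult \<pi>_b_inv scaleR_2)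
  also have "\<pi> (g \<otimes> w) (backward_sum m gs) + \<pi> g (b (inv g) - m)
      = \<pi> (g \<otimes> w) (backward_sum m (g # gs))"
    using g w by (simp add: \<pi>_add \<pi>_mult \<pi>_inv' flip: w_def)
  finally show ?case by (simp add: w_def)
qed

context
  fixes \<mu> :: "'a pmf" and p K :: real
  assumes symmetric: "symmetric_prob G \<mu>"
    and p: "1 \<le> p" "p \<le> 2"
    and smooth: "two_point_smooth TYPE('b) p K"
    and finite_moment: "(\<integral>\<^sup>+g. ennreal (norm (b g) powr p) \<partial>\<mu>) < \<infinity>"
begin

lemma supp_\<mu>: "set_pmf \<mu> \<subseteq> carrier G"
  using symmetric unfolding symmetric_prob_def by blast

lemma smooth_increment_cocycle:
  "(\<integral>\<^sup>+g. ennreal (norm (x + (b g - pmf_mean \<mu> b)) powr p) \<partial>\<mu>)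
     \<le> ennreal (norm x powr p)
        + ennreal K * (\<integral>\<^sup>+g. ennreal (norm (b g - pmf_mean \<mu> b) powr p) \<partial>\<mu>)"
  by (rule smooth_increment[OF p(1) finite_moment smooth])

text \<open>Conditionally on the earlier steps, the new increment is the image of a centred vector under an
  isometry \<open>\<pi> w\<close>; applying its inverse to the whole sum reduces the claim to \<open>smooth_increment\<close>.\<close>

lemma moment_forward_sum:
  "(\<integral>\<^sup>+gs. ennreal (norm (forward_sum (pmf_mean \<mu> b) gs) powr p) \<partial>replicate_pmf t \<mu>)
     \<le> of_nat t * (ennreal K * (\<integral>\<^sup>+g. ennreal (norm (b g - pmf_mean \<mu> b) powr p) \<partial>\<mu>))"
    (is "?F t \<le> of_nat t * ?V")
proof (induction t)
  case 0
  then show ?case by simp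
next
  case (Suc t)
  let ?m = "pmf_mean \<mu> b"
  have "?F (Suc t) = (\<integral>\<^sup>+gs. \<integral>\<^sup>+g. ennreal (norm (forward_sum ?m (gs @ [g])) powr p) \<partial>\<mu> \<partial>replicate_pmf t \<mu>)"
    by (rule nn_integral_replicate_pmf_snoc)
  also have "\<dots> \<le> (\<integral>\<^sup>+gs. ennreal (norm (forward_sum ?m gs) powr p) + ?V \<partial>replicate_pmf t \<mu>)"
  proof (rule nn_integral_replicate_pmf_mono[OF supp_\<mu>])
    fix gs assume gs: "set gs \<subseteq> carrier G"
    define w where "w = word_prod gs"
    have w: "w \<in> carrier G" using gs by (simp add: w_def)
    have "(\<integral>\<^sup>+g. ennreal (norm (forward_sum ?m (gs @ [g])) powr p) \<partial>\<mu>)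
        = (\<integral>\<^sup>+g. ennreal (norm (\<pi> (inv w) (forward_sum ?m gs) + (b g - ?m)) powr p) \<partial>\<mu>)"
      using gs supp_\<mu>
      by (intro nn_integral_cong_AE)
        (auto simp: AE_measure_pmf_iff forward_sum_snoc norm_add_\<pi> w simp flip: w_def)
    also have "\<dots> \<le> ennreal (norm (\<pi> (inv w) (forward_sum ?m gs)) powr p) + ?V"
      by (rule smooth_increment_cocycle)
    finally show "(\<integral>\<^sup>+g. ennreal (norm (forward_sum ?m (gs @ [g])) powr p) \<partial>\<mu>)
        \<le> ennreal (norm (forward_sum ?m gs) powr p) + ?V"
      using w by (simp add: norm_\<pi>)
  qed
  also have "\<dots> = ?F t + ?V"
    by (simp add: nn_integral_add)
  also have "\<dots> \<le> of_nat t * ?V + ?V"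
    by (intro add_right_mono Suc)
  finally show ?case by (simp add: distrib_right add.commute)
qed

text \<open>As for the forward sum. The increments involve \<open>b (inv g)\<close>, which is distributed like \<open>b g\<close> since
  \<open>\<mu>\<close> is symmetric.\<close>

lemma moment_backward_sum:
  "(\<integral>\<^sup>+gs. ennreal (norm (backward_sum (pmf_mean \<mu> b) gs) powr p) \<partial>replicate_pmf t \<mu>)
     \<le> of_nat t * (ennreal K * (\<integral>\<^sup>+g. ennreal (norm (b g - pmf_mean \<mu> b) powr p) \<partial>\<mu>))"
    (is "?F t \<le> of_nat t * ?V")
proof (induction t)
  case 0
  then show ?case by simp
next
  case (Suc t)
  let ?m = "pmf_mean \<mu> b"
  have "?F (Suc t) = (\<integral>\<^sup>+gs. \<integral>\<^sup>+g. ennreal (norm (backward_sum ?m (g # gs)) powr p) \<partial>\<mu> \<partial>replicate_pmf t \<mu>)"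
    by (rule nn_integral_replicate_pmf_Cons)
  also have "\<dots> \<le> (\<integral>\<^sup>+gs. ennreal (norm (backward_sum ?m gs) powr p) + ?V \<partial>replicate_pmf t \<mu>)"
  proof (rule nn_integral_replicate_pmf_mono[OF supp_\<mu>])
    fix gs assume gs: "set gs \<subseteq> carrier G"
    define w where "w = word_prod gs"
    have w: "w \<in> carrier G" using gs by (simp add: w_def)
    have "(\<integral>\<^sup>+g. ennreal (norm (backward_sum ?m (g # gs)) powr p) \<partial>\<mu>)
        = (\<integral>\<^sup>+g. ennreal (norm (\<pi> w (backward_sum ?m gs) + (b (inv g) - ?m)) powr p) \<partial>\<mu>)"
      by (simp add: norm_add_\<pi> w flip: w_def)
    also have "\<dots> = (\<integral>\<^sup>+g. ennreal (norm (\<pi> w (backward_sum ?m gs) + (b g - ?m)) powr p)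
                      \<partial>map_pmf (\<lambda>g. inv g) \<mu>)"
      by simp
    also have "\<dots> \<le> ennreal (norm (\<pi> w (backward_sum ?m gs)) powr p) + ?V"
      unfolding map_pmf_inv_symmetric[OF symmetric] by (rule smooth_increment_cocycle)
    finally show "(\<integral>\<^sup>+g. ennreal (norm (backward_sum ?m (g # gs)) powr p) \<partial>\<mu>)
        \<le> ennreal (norm (backward_sum ?m gs) powr p) + ?V"
      using w by (simp add: norm_\<pi>)
  qed
  also have "\<dots> = ?F t + ?V"
    by (simp add: nn_integral_add)
  also have "\<dots> \<le> of_nat t * ?V + ?V"
    by (intro add_right_mono Suc)
  finally show ?case by (simp add: distrib_right add.commute)
qed

text \<open>The displacement along the walk has \<open>p\<close>-th moment growing at most linearly in time. This is Markov
  type \<open>p\<close> for random walks and cocycles, with the constant that results from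
  \<open>powr_add_le\<close>.\<close>

lemma moment_cocycle:
  assumes t: "t \<ge> 1"
  shows "(\<integral>\<^sup>+gs. ennreal (norm (b (word_prod gs)) powr p) \<partial>replicate_pmf t \<mu>)
     \<le> ennreal ((256 * K + 4) * real t) * (\<integral>\<^sup>+g. ennreal (norm (b g) powr p) \<partial>\<mu>)"
proof -
  define m where "m = pmf_mean \<mu> b"
  define M where "M = (\<integral>\<^sup>+g. ennreal (norm (b g) powr p) \<partial>\<mu>)"
  define F where "F gs = norm (forward_sum m gs)" for gs
  define B where "B gs = norm (backward_sum m gs)" for gs
  have K: "K \<ge> 0" using smooth by (simp add: two_point_smooth_def)
  \<comment> \<open>The mean is controlled by the \<open>p\<close>-th moment, and so is the centred cocycle.\<close>
  have mM: "ennreal (norm m powr p) \<le> M"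
    using norm_diff_pmf_mean_powr_le[OF p(1) finite_moment, of 0] by (simp add: m_def M_def)
  have "(\<integral>\<^sup>+g. ennreal (norm (b g - m) powr p) \<partial>\<mu>)
      \<le> (\<integral>\<^sup>+g. 4 * (ennreal (norm (b g) powr p) + ennreal (norm m powr p)) \<partial>\<mu>)"
  proof (rule nn_integral_mono)
    fix g
    have "norm (b g - m) powr p \<le> (norm (b g) + norm m) powr p"
      using p by (intro powr_mono2 norm_triangle_ineq4) auto
    also have "\<dots> \<le> 4 * (norm (b g) powr p + norm m powr p)"
      using p by (intro powr_add_le) auto
    finally have "ennreal (norm (b g - m) powr p)
        \<le> ennreal (4 * (norm (b g) powr p + norm m powr p))"
      by (rule ennreal_leI)
    then show "ennreal (norm (b g - m) powr p)
        \<le> 4 * (ennreal (norm (b g) powr p) + ennreal (norm m powr p))"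
      by (simp add: ennreal_mult)
  qed
  also have "\<dots> = 4 * (M + ennreal (norm m powr p))"
    by (simp add: nn_integral_cmult nn_integral_add M_def)
  also have "\<dots> \<le> 4 * (M + M)"
    by (intro mult_left_mono add_left_mono mM) simp
  finally have V: "(\<integral>\<^sup>+g. ennreal (norm (b g - m) powr p) \<partial>\<mu>) \<le> 8 * M"
    by (simp add: algebra_simps flip: mult_2)
  have S: "of_nat t * (ennreal K * (\<integral>\<^sup>+g. ennreal (norm (b g - m) powr p) \<partial>\<mu>))
      \<le> of_nat t * (ennreal K * (8 * M))"
    by (intro mult_left_mono V) simp_all
  have "(\<integral>\<^sup>+gs. ennreal (norm (b (word_prod gs)) powr p) \<partial>replicate_pmf t \<mu>)
     \<le> (\<integral>\<^sup>+gs. 16 * ennreal (F gs powr p) + 16 * ennreal (B gs powr p) + 4 * ennreal (norm m powr p)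
           \<partial>replicate_pmf t \<mu>)"
  proof (rule nn_integral_replicate_pmf_mono[OF supp_\<mu>])
    fix gs assume gs: "set gs \<subseteq> carrier G"
    have "2 * norm (b (word_prod gs)) = norm (2 *\<^sub>R b (word_prod gs))" by simp
    also have "\<dots> \<le> norm (forward_sum m gs) + norm (\<pi> (word_prod gs) (backward_sum m gs))
        + (norm m + norm (\<pi> (word_prod gs) m))"
      unfolding forward_backward_decomposition[OF gs, of m]
      by (intro order_trans[OF norm_triangle_ineq] add_mono norm_triangle_ineq4)
    also have "\<dots> \<le> 2 * ((F gs + B gs) + norm m)"
      using gs by (simp add: norm_\<pi> F_def B_def)
    finally have "norm (b (word_prod gs)) powr p \<le> ((F gs + B gs) + norm m) powr p"
      using p by (intro powr_mono2) auto
    also have "\<dots> \<le> 4 * ((F gs + B gs) powr p + norm m powr p)"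
      using p by (intro powr_add_le) (auto simp: F_def B_def)
    also have "\<dots> \<le> 4 * (4 * (F gs powr p + B gs powr p) + norm m powr p)"
      using p by (intro mult_left_mono add_right_mono powr_add_le) (auto simp: F_def B_def)
    finally have "norm (b (word_prod gs)) powr p
        \<le> 16 * F gs powr p + 16 * B gs powr p + 4 * norm m powr p"
      by simp
    then have "ennreal (norm (b (word_prod gs)) powr p)
        \<le> ennreal (16 * F gs powr p + 16 * B gs powr p + 4 * norm m powr p)"
      by (rule ennreal_leI)
    also have "\<dots> = 16 * ennreal (F gs powr p) + 16 * ennreal (B gs powr p) + 4 * ennreal (norm m powr p)"
      by (simp add: ennreal_plus ennreal_mult)
    finally show "ennreal (norm (b (word_prod gs)) powr p)
        \<le> 16 * ennreal (F gs powr p) + 16 * ennreal (B gs powr p) + 4 * ennreal (norm m powr p)" .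
  qed
  also have "\<dots> = 16 * (\<integral>\<^sup>+gs. ennreal (F gs powr p) \<partial>replicate_pmf t \<mu>)
      + 16 * (\<integral>\<^sup>+gs. ennreal (B gs powr p) \<partial>replicate_pmf t \<mu>) + 4 * ennreal (norm m powr p)"
    by (simp add: nn_integral_add nn_integral_cmult)
  also have "\<dots> \<le> 16 * (of_nat t * (ennreal K * (8 * M))) + 16 * (of_nat t * (ennreal K * (8 * M)))
      + 4 * (of_nat t * M)"
  proof (intro add_mono mult_left_mono)
    show "(\<integral>\<^sup>+gs. ennreal (F gs powr p) \<partial>replicate_pmf t \<mu>) \<le> of_nat t * (ennreal K * (8 * M))"
      using moment_forward_sum[of t] S unfolding F_def m_def by (rule order_trans)
    show "(\<integral>\<^sup>+gs. ennreal (B gs powr p) \<partial>replicate_pmf t \<mu>) \<le> of_nat t * (ennreal K * (8 * M))"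
      using moment_backward_sum[of t] S unfolding B_def m_def by (rule order_trans)
    have "1 * M \<le> of_nat t * M"
      using t by (intro mult_right_mono) auto
    then show "ennreal (norm m powr p) \<le> of_nat t * M"
      using mM by simp
  qed simp_all
  also have "\<dots> = (128 + 128) * (ennreal K * (of_nat t * M)) + 4 * (of_nat t * M)"
    unfolding distrib_right by (simp add: mult_ac)
  also have "\<dots> = (256 * ennreal K + 4) * of_nat t * M"
    by (simp add: algebra_simps)
  also have "\<dots> = ennreal ((256 * K + 4) * real t) * M"
    using K by (simp add: ennreal_mult ennreal_plus ennreal_of_nat_eq_real_of_nat)
  finally show ?thesis by (simp add: M_def)
qed

end

end

section \<open>Equivariant maps and displacement of the walk\<close>

text \<open>The linear part of each affine isometry of the action is \<open>x \<mapsto> \<tau> g x - \<tau> g 0\<close>.\<close>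

lemma equivariant_map_imp_cocycle:
  fixes G :: "('a, 'm) monoid_scheme" (structure) and \<psi> :: "'a \<Rightarrow> 'b::banach"
  assumes "group G" "equivariant_map G \<psi>"
  obtains \<pi> where "isometric_cocycle G \<pi> (\<lambda>g. \<psi> g - \<psi> \<one>)"
proof -
  interpret group G by fact
  obtain \<tau> v where act: "group_action G (UNIV :: 'b set) \<tau>"
    and iso: "\<And>g. g \<in> carrier G \<Longrightarrow> affine_isometry (\<tau> g)"
    and \<psi>: "\<And>x. x \<in> carrier G \<Longrightarrow> \<psi> x = \<tau> x v"
    using assms(2) unfolding equivariant_map_def by blast
  interpret group_action G "UNIV :: 'b set" \<tau> by fact
  have \<tau>_one: "\<tau> \<one> x = x" for x
    using id_eq_one by (metis UNIV_I restrict_apply')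
  have \<tau>_mult: "\<tau> (g \<otimes> h) x = \<tau> g (\<tau> h x)" if "g \<in> carrier G" "h \<in> carrier G" for g h x
    using composition_rule that by simp
  define \<pi> where "\<pi> g x = \<tau> g x - \<tau> g 0" for g x
  have lin: "linear (\<pi> g)" and diff: "\<tau> g x - \<tau> g y = \<pi> g (x - y)"
    and dist: "norm (\<tau> g x - \<tau> g y) = norm (x - y)"
    if g: "g \<in> carrier G" for g x y
  proof -
    obtain A a where A: "linear A" and \<tau>: "\<And>x. \<tau> g x = A x + a"
      and d: "\<And>x y. dist (\<tau> g x) (\<tau> g y) = dist x y"
      using iso[OF g] unfolding affine_isometry_def by blast
    have "\<pi> g = A"
      by (rule ext) (simp add: \<pi>_def \<tau> linear_0[OF A])
    then show "linear (\<pi> g)" "\<tau> g x - \<tau> g y = \<pi> g (x - y)"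
      using A by (simp_all add: \<tau> linear_diff)
    show "norm (\<tau> g x - \<tau> g y) = norm (x - y)"
      using d[of x y] by (simp add: dist_norm)
  qed
  have "isometric_cocycle G \<pi> (\<lambda>g. \<psi> g - \<psi> \<one>)"
  proof (intro isometric_cocycle.intro isometric_cocycle_axioms.intro is_group)
    fix g assume "g \<in> carrier G"
    then show "linear (\<pi> g)" by (rule lin)
  next
    fix g x assume g: "g \<in> carrier G"
    show "norm (\<pi> g x) = norm x" using dist[OF g, of x 0] by (simp add: \<pi>_def)
  next
    fix g h x assume g: "g \<in> carrier G" and h: "h \<in> carrier G"
    show "\<pi> (g \<otimes> h) x = \<pi> g (\<pi> h x)"
      using diff[OF g, of "\<tau> h x" "\<tau> h 0"] g h by (simp add: \<pi>_def[of "g \<otimes> h"] \<pi>_def[of h] \<tau>_mult)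
  next
    fix g h assume g: "g \<in> carrier G" and h: "h \<in> carrier G"
    show "\<psi> (g \<otimes> h) - \<psi> \<one> = \<psi> g - \<psi> \<one> + \<pi> g (\<psi> h - \<psi> \<one>)"
      using diff[OF g, of "\<tau> h v" v] g h by (simp add: \<psi> \<tau>_mult \<tau>_one diff_eq_eq add.commute)
  qed (simp_all add: \<pi>_def \<tau>_one)
  then show thesis by (rule that)
qed

locale proper_metric_group = group G for G :: "('a, 'm) monoid_scheme" (structure) +
  fixes \<rho> :: "'a \<Rightarrow> 'a \<Rightarrow> real"
  assumes metric: "Metric_space (carrier G) \<rho>"
    and left_invariant: "\<lbrakk>g \<in> carrier G; x \<in> carrier G; y \<in> carrier G\<rbrakk> \<Longrightarrow> \<rho> (g \<otimes> x) (g \<otimes> y) = \<rho> x y"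
    and finite_balls: "r \<ge> 0 \<Longrightarrow> finite {x \<in> carrier G. \<rho> x \<one> \<le> r}"
begin

lemma nonneg_\<rho> [simp]: "0 \<le> \<rho> x y"
  using metric by (rule Metric_space.nonneg)

lemma \<rho>_one_one [simp]: "\<rho> \<one> \<one> = 0"
  using Metric_space.mdist_zero[OF metric] by simp

lemma \<rho>_mult_le: "g \<in> carrier G \<Longrightarrow> x \<in> carrier G \<Longrightarrow> \<rho> (g \<otimes> x) \<one> \<le> \<rho> g \<one> + \<rho> x \<one>"
  using Metric_space.triangle[OF metric, of "g \<otimes> x" g \<one>] left_invariant[of g x \<one>] by simp

text \<open>The ball of radius \<open>1\<close> is finite, so the positive distances to \<open>\<one>\<close> are bounded away from \<open>0\<close>.\<close>

lemma uniformly_discrete: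
  obtains r where "r > 0" "\<And>x. x \<in> carrier G \<Longrightarrow> x \<noteq> \<one> \<Longrightarrow> r \<le> \<rho> x \<one>"
proof -
  \<comment> \<open>The element \<open>1\<close> accounts for all points outside the unit ball.\<close>
  define S where "S = insert 1 ((\<lambda>x. \<rho> x \<one>) ` ({x \<in> carrier G. \<rho> x \<one> \<le> 1} - {\<one>}))"
  have fin: "finite S" using finite_balls[of 1] by (simp add: S_def)
  have "\<forall>s\<in>S. 0 < s"
    using Metric_space.mdist_pos_less[OF metric] by (auto simp: S_def)
  then have "Min S > 0"
    using fin by (subst Min_gr_iff) (auto simp: S_def)
  moreover have "Min S \<le> \<rho> x \<one>" if "x \<in> carrier G" "x \<noteq> \<one>" for x
  proof (cases "\<rho> x \<one> \<le> 1")
    case True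
    then show ?thesis using that fin by (intro Min_le) (auto simp: S_def)
  next
    case False
    have "Min S \<le> 1" using fin by (intro Min_le) (auto simp: S_def)
    then show ?thesis using False by simp
  qed
  ultimately show thesis by (rule that)
qed

text \<open>A bound, uniform over all symmetric step distributions, of the \<open>q\<close>-th moment of the walk by \<open>t\<close> times
  the \<open>p\<close>-th moment of one step. For \<open>q \<ge> 1\<close> Jensen's inequality shows that it bounds the displacement
  exponents by \<open>1 / q\<close>. Such a bound comes from the triangle inequality for \<open>q = 1\<close> and from an equivariant
  map for \<open>q = p * \<alpha>\<close>; the former covers compression exponents \<open>\<alpha> < 1 / p\<close>, for which Jensen's
  inequality goes the wrong way.\<close>

definition moment_growth :: "real \<Rightarrow> real \<Rightarrow> bool" where
  "moment_growth p q \<longleftrightarrow> (\<exists>C>0. \<forall>t\<ge>1. \<forall>\<mu>. symmetric_prob G \<mu> \<longrightarrow>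
     integrable (measure_pmf \<mu>) (\<lambda>x. \<rho> x \<one> powr p) \<longrightarrow>
     (\<integral>\<^sup>+gs. ennreal (\<rho> (word_prod gs) \<one> powr q) \<partial>replicate_pmf t \<mu>)
       \<le> ennreal (C * real t) * (\<integral>\<^sup>+x. ennreal (\<rho> x \<one> powr p) \<partial>\<mu>))"

text \<open>The triangle inequality bounds the displacement by the sum of the step lengths. Step lengths are
  bounded by a multiple of their \<open>p\<close>-th powers, since nonzero ones are bounded away from \<open>0\<close>.\<close>

lemma moment_growth_1:
  assumes "1 \<le> p"
  shows "moment_growth p 1"
proof -
  obtain r where r: "r > 0" "\<And>x. x \<in> carrier G \<Longrightarrow> x \<noteq> \<one> \<Longrightarrow> r \<le> \<rho> x \<one>"
    using uniformly_discrete by blast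
  have triangle: "(\<integral>\<^sup>+gs. ennreal (\<rho> (word_prod gs) \<one>) \<partial>replicate_pmf t \<mu>)
      \<le> of_nat t * (\<integral>\<^sup>+x. ennreal (\<rho> x \<one>) \<partial>\<mu>)" (is "?F t \<le> of_nat t * ?V")
    if supp: "set_pmf \<mu> \<subseteq> carrier G" for \<mu> t
  proof (induction t)
    case (Suc t)
    have "?F (Suc t) = (\<integral>\<^sup>+gs. \<integral>\<^sup>+g. ennreal (\<rho> (word_prod (g # gs)) \<one>) \<partial>\<mu> \<partial>replicate_pmf t \<mu>)"
      by (rule nn_integral_replicate_pmf_Cons)
    also have "\<dots> \<le> (\<integral>\<^sup>+gs. ennreal (\<rho> (word_prod gs) \<one>) + ?V \<partial>replicate_pmf t \<mu>)"
    proof (rule nn_integral_replicate_pmf_mono[OF supp])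
      fix gs assume gs: "set gs \<subseteq> carrier G"
      have "(\<integral>\<^sup>+g. ennreal (\<rho> (word_prod (g # gs)) \<one>) \<partial>\<mu>)
          \<le> (\<integral>\<^sup>+g. ennreal (\<rho> (word_prod gs) \<one>) + ennreal (\<rho> g \<one>) \<partial>\<mu>)"
      proof (rule nn_integral_mono_AE, unfold AE_measure_pmf_iff, rule ballI)
        fix g assume "g \<in> set_pmf \<mu>"
        then have "\<rho> (word_prod (g # gs)) \<one> \<le> \<rho> (word_prod gs) \<one> + \<rho> g \<one>"
          using \<rho>_mult_le[of g "word_prod gs"] supp gs by auto
        then show "ennreal (\<rho> (word_prod (g # gs)) \<one>) \<le> ennreal (\<rho> (word_prod gs) \<one>) + ennreal (\<rho> g \<one>)"
          by (simp add: ennreal_leI flip: ennreal_plus)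
      qed
      then show "(\<integral>\<^sup>+g. ennreal (\<rho> (word_prod (g # gs)) \<one>) \<partial>\<mu>) \<le> ennreal (\<rho> (word_prod gs) \<one>) + ?V"
        by (simp add: nn_integral_add)
    qed
    also have "\<dots> = ?F t + ?V" by (simp add: nn_integral_add)
    also have "\<dots> \<le> of_nat t * ?V + ?V" by (intro add_right_mono Suc)
    finally show ?case by (simp add: distrib_right add.commute)
  qed simp
  have le: "\<rho> x \<one> \<le> r powr (1 - p) * \<rho> x \<one> powr p" if "x \<in> carrier G" for x
  proof (cases "x = \<one>")
    case False
    then have "r \<le> \<rho> x \<one>" using r that by simp
    then have "\<rho> x \<one> powr (1 - p) * \<rho> x \<one> powr p \<le> r powr (1 - p) * \<rho> x \<one> powr p"
      using r assms by (intro mult_right_mono powr_mono2') auto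
    then show ?thesis
      using \<open>r \<le> \<rho> x \<one>\<close> r by (simp flip: powr_add)
  qed simp
  show ?thesis
    unfolding moment_growth_def
  proof (intro exI[of _ "r powr (1 - p)"] conjI allI impI)
    show "r powr (1 - p) > 0" using r by simp
    fix t :: nat and \<mu>
    assume "symmetric_prob G \<mu>"
    then have supp: "set_pmf \<mu> \<subseteq> carrier G" unfolding symmetric_prob_def by blast
    have "(\<integral>\<^sup>+x. ennreal (\<rho> x \<one>) \<partial>\<mu>) \<le> (\<integral>\<^sup>+x. ennreal (r powr (1 - p)) * ennreal (\<rho> x \<one> powr p) \<partial>\<mu>)"
      using le supp
      by (intro nn_integral_mono_AE) (auto simp: AE_measure_pmf_iff ennreal_leI simp flip: ennreal_mult)
    also have "\<dots> = ennreal (r powr (1 - p)) * (\<integral>\<^sup>+x. ennreal (\<rho> x \<one> powr p) \<partial>\<mu>)"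
      by (simp add: nn_integral_cmult)
    finally have "of_nat t * (\<integral>\<^sup>+x. ennreal (\<rho> x \<one>) \<partial>\<mu>)
        \<le> of_nat t * (ennreal (r powr (1 - p)) * (\<integral>\<^sup>+x. ennreal (\<rho> x \<one> powr p) \<partial>\<mu>))"
      by (intro mult_left_mono) auto
    with triangle[OF supp, of t] have "(\<integral>\<^sup>+gs. ennreal (\<rho> (word_prod gs) \<one>) \<partial>replicate_pmf t \<mu>)
        \<le> of_nat t * (ennreal (r powr (1 - p)) * (\<integral>\<^sup>+x. ennreal (\<rho> x \<one> powr p) \<partial>\<mu>))"
      by (rule order_trans)
    then show "(\<integral>\<^sup>+gs. ennreal (\<rho> (word_prod gs) \<one> powr 1) \<partial>replicate_pmf t \<mu>)
        \<le> ennreal (r powr (1 - p) * real t) * (\<integral>\<^sup>+x. ennreal (\<rho> x \<one> powr p) \<partial>\<mu>)"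
      by (simp add: ennreal_mult ennreal_of_nat_eq_real_of_nat mult_ac)
  qed
qed

text \<open>The compression bound gives \<open>\<rho> x \<one> powr (p * \<alpha>) \<le> c powr - p * norm (b x) powr p\<close>, where \<open>b\<close> is the cocycle
  of \<open>\<psi>\<close>; the moments of \<open>b\<close> along the walk are bounded by its moments over one step, hence, by the
  Lipschitz bound, by the \<open>p\<close>-th moment of the step length.\<close>

lemma moment_growth_compression:
  fixes \<psi> :: "'a \<Rightarrow> 'b::banach"
  assumes p: "1 \<le> p" "p \<le> 2" and smooth: "smoothness_power_type TYPE('b) p"
    and equi: "equivariant_map G \<psi>"
    and L: "L \<ge> 0" "\<And>x y. x \<in> carrier G \<Longrightarrow> y \<in> carrier G \<Longrightarrow> norm (\<psi> x - \<psi> y) \<le> L * \<rho> x y"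
    and c: "c > 0" "\<And>x y. x \<in> carrier G \<Longrightarrow> y \<in> carrier G \<Longrightarrow> norm (\<psi> x - \<psi> y) \<ge> c * \<rho> x y powr \<alpha>"
  shows "moment_growth p (p * \<alpha>)"
proof -
  obtain K where K: "two_point_smooth TYPE('b) p K"
    using smoothness_imp_two_point[OF p smooth] by blast
  then have "K \<ge> 0" by (simp add: two_point_smooth_def)
  define b where "b g = \<psi> g - \<psi> \<one>" for g
  obtain \<pi> where "isometric_cocycle G \<pi> b"
    using equivariant_map_imp_cocycle[OF is_group equi] unfolding b_def by blast
  then interpret isometric_cocycle G \<pi> b .
  define C where "C = c powr (- p) * ((256 * K + 4) * L powr p)"
  have "C \<ge> 0" using \<open>K \<ge> 0\<close> by (simp add: C_def)
  have upper: "norm (b x) powr p \<le> L powr p * \<rho> x \<one> powr p" if "x \<in> carrier G" for x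
  proof -
    have "norm (b x) powr p \<le> (L * \<rho> x \<one>) powr p"
      using L(2)[OF that one_closed] p by (intro powr_mono2) (auto simp: b_def)
    then show ?thesis using L by (simp add: powr_mult)
  qed
  have lower: "\<rho> x \<one> powr (p * \<alpha>) \<le> c powr (- p) * norm (b x) powr p" if "x \<in> carrier G" for x
  proof -
    have "(c * \<rho> x \<one> powr \<alpha>) powr p \<le> norm (b x) powr p"
      using c(2)[OF that one_closed] c(1) p by (intro powr_mono2) (auto simp: b_def)
    then have "c powr p * \<rho> x \<one> powr (p * \<alpha>) \<le> norm (b x) powr p"
      using c(1) by (simp add: powr_mult powr_powr mult.commute)
    then show ?thesis using c(1) by (simp add: powr_minus field_simps)
  qed
  show ?thesis
    unfolding moment_growth_def
    \<comment> \<open>\<open>C\<close> itself may be \<open>0\<close>, namely if \<open>L = 0\<close>.\<close>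
  proof (intro exI[of _ "C + 1"] conjI allI impI)
    show "C + 1 > 0" using \<open>C \<ge> 0\<close> by simp
    fix t :: nat and \<mu>
    assume t: "t \<ge> 1" and sym: "symmetric_prob G \<mu>"
      and int: "integrable (measure_pmf \<mu>) (\<lambda>x. \<rho> x \<one> powr p)"
    have supp: "set_pmf \<mu> \<subseteq> carrier G" using sym unfolding symmetric_prob_def by blast
    define R where "R = (\<integral>\<^sup>+x. ennreal (\<rho> x \<one> powr p) \<partial>\<mu>)"
    have R: "R < \<infinity>"
      unfolding R_def using int by (simp add: nn_integral_eq_integral)
    have "(\<integral>\<^sup>+x. ennreal (norm (b x) powr p) \<partial>\<mu>)
        \<le> (\<integral>\<^sup>+x. ennreal (L powr p) * ennreal (\<rho> x \<one> powr p) \<partial>\<mu>)"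
      using upper supp
      by (intro nn_integral_mono_AE) (auto simp: AE_measure_pmf_iff ennreal_leI simp flip: ennreal_mult)
    also have "\<dots> = ennreal (L powr p) * R"
      by (simp add: nn_integral_cmult R_def)
    finally have M: "(\<integral>\<^sup>+x. ennreal (norm (b x) powr p) \<partial>\<mu>) \<le> ennreal (L powr p) * R" .
    also have "\<dots> < \<infinity>" using R by (simp add: ennreal_mult_less_top)
    finally have fin: "(\<integral>\<^sup>+x. ennreal (norm (b x) powr p) \<partial>\<mu>) < \<infinity>" .
    have "(\<integral>\<^sup>+gs. ennreal (\<rho> (word_prod gs) \<one> powr (p * \<alpha>)) \<partial>replicate_pmf t \<mu>)
        \<le> (\<integral>\<^sup>+gs. ennreal (c powr (- p)) * ennreal (norm (b (word_prod gs)) powr p) \<partial>replicate_pmf t \<mu>)"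
      using lower
      by (intro nn_integral_replicate_pmf_mono[OF supp]) (auto simp: ennreal_leI simp flip: ennreal_mult)
    also have "\<dots> = ennreal (c powr (- p)) * (\<integral>\<^sup>+gs. ennreal (norm (b (word_prod gs)) powr p) \<partial>replicate_pmf t \<mu>)"
      by (simp add: nn_integral_cmult)
    also have "\<dots> \<le> ennreal (c powr (- p)) * (ennreal ((256 * K + 4) * real t) * (ennreal (L powr p) * R))"
      using moment_cocycle[OF sym p K fin t] M
      by (intro mult_left_mono order_trans[OF _ mult_left_mono[OF M]]) auto
    also have "\<dots> = ennreal (C * real t) * R"
      using \<open>K \<ge> 0\<close> by (simp add: C_def ennreal_mult mult_ac)
    also have "\<dots> \<le> ennreal ((C + 1) * real t) * R"
      by (intro mult_right_mono ennreal_leI) auto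
    finally show "(\<integral>\<^sup>+gs. ennreal (\<rho> (word_prod gs) \<one> powr (p * \<alpha>)) \<partial>replicate_pmf t \<mu>)
        \<le> ennreal ((C + 1) * real t) * R" .
  qed
qed

end

section \<open>Displacement exponents\<close>

context proper_metric_group
begin

lemma walk_pmf_1:
  assumes "symmetric_prob G \<mu>"
  shows "walk_pmf G \<mu> 1 = \<mu>"
proof -
  have supp: "set_pmf \<mu> \<subseteq> carrier G" using assms unfolding symmetric_prob_def by blast
  have "walk_pmf G \<mu> 1 = map_pmf (\<lambda>x. x \<otimes> \<one>) \<mu>"
    unfolding walk_pmf_def replicate_pmf_1 by (simp add: map_pmf_comp)
  also have "\<dots> = map_pmf id \<mu>"
    by (rule map_pmf_cong) (use supp in auto)
  finally show ?thesis by simp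
qed

abbreviation mean_displacement :: "'a pmf \<Rightarrow> nat \<Rightarrow> real" where
  "mean_displacement \<mu> t \<equiv> measure_pmf.expectation (walk_pmf G \<mu> t) (\<lambda>x. \<rho> x \<one>)"

abbreviation step_moment :: "real \<Rightarrow> 'a pmf \<Rightarrow> real" where
  "step_moment p \<mu> \<equiv> measure_pmf.expectation (walk_pmf G \<mu> 1) (\<lambda>x. \<rho> x \<one> powr p)"

lemma mean_displacement_bound:
  assumes "1 \<le> q" "moment_growth p q"
  obtains C where "C > 0"
    "\<And>t \<mu>. 1 \<le> t \<Longrightarrow> symmetric_prob G \<mu> \<Longrightarrow> integrable (measure_pmf \<mu>) (\<lambda>x. \<rho> x \<one> powr p) \<Longrightarrow>
       mean_displacement \<mu> t powr q \<le> C * (real t * step_moment p \<mu>)"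
proof -
  obtain C where C: "C > 0" and bound:
    "\<And>t \<mu>. 1 \<le> t \<Longrightarrow> symmetric_prob G \<mu> \<Longrightarrow> integrable (measure_pmf \<mu>) (\<lambda>x. \<rho> x \<one> powr p) \<Longrightarrow>
       (\<integral>\<^sup>+gs. ennreal (\<rho> (word_prod gs) \<one> powr q) \<partial>replicate_pmf t \<mu>)
         \<le> ennreal (C * real t) * (\<integral>\<^sup>+x. ennreal (\<rho> x \<one> powr p) \<partial>\<mu>)"
    using assms(2) unfolding moment_growth_def by blast
  have "mean_displacement \<mu> t powr q \<le> C * (real t * step_moment p \<mu>)"
    if t: "1 \<le> t" and sym: "symmetric_prob G \<mu>" and int: "integrable (measure_pmf \<mu>) (\<lambda>x. \<rho> x \<one> powr p)"
    for t \<mu>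
  proof -
    have nn: "0 \<le> measure_pmf.expectation \<mu> (\<lambda>x. \<rho> x \<one> powr p)"
      by (intro integral_nonneg_AE) auto
    have "ennreal (mean_displacement \<mu> t powr q)
        \<le> (\<integral>\<^sup>+x. ennreal (\<rho> x \<one> powr q) \<partial>walk_pmf G \<mu> t)"
      using assms(1) by (intro Jensen_powr) auto
    also have "\<dots> = (\<integral>\<^sup>+gs. ennreal (\<rho> (word_prod gs) \<one> powr q) \<partial>replicate_pmf t \<mu>)"
      by (simp add: walk_pmf_def)
    also have "\<dots> \<le> ennreal (C * real t) * (\<integral>\<^sup>+x. ennreal (\<rho> x \<one> powr p) \<partial>\<mu>)"
      by (rule bound[OF t sym int])
    also have "\<dots> = ennreal (C * real t) * ennreal (step_moment p \<mu>)"
      using int by (simp only: nn_integral_eq_integral walk_pmf_1[OF sym]) (simp add: nn_integral_eq_integral)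
    also have "\<dots> = ennreal (C * (real t * step_moment p \<mu>))"
      using C nn by (simp add: walk_pmf_1[OF sym, unfolded One_nat_def] mult.assoc flip: ennreal_mult)
    finally show ?thesis
      using C nn by (subst (asm) ennreal_le_iff) (simp_all add: walk_pmf_1[OF sym, unfolded One_nat_def])
  qed
  with C show thesis by (rule that)
qed

text \<open>A step away from \<open>\<one>\<close> has length at least some \<open>r > 0\<close>, and the expected number of such steps tends to
  infinity. Hence the logarithm in the denominator of the displacement exponent tends to infinity and
  multiplicative constants do not influence the limit.\<close>

lemma step_moment_at_top:
  assumes "admissible_seq G \<rho> p \<mu>" "0 \<le> p"
  shows "filterlim (\<lambda>t. real t * step_moment p (\<mu> t)) at_top sequentially"
proof -
  obtain r where r: "r > 0" "\<And>x. x \<in> carrier G \<Longrightarrow> x \<noteq> \<one> \<Longrightarrow> r \<le> \<rho> x \<one>"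
    using uniformly_discrete by blast
  have top: "filterlim (\<lambda>t. real t * measure_pmf.prob (\<mu> t) (carrier G - {\<one>})) at_top sequentially"
    and adm: "\<And>t. t \<ge> 1 \<Longrightarrow> symmetric_prob G (\<mu> t)"
      "\<And>t. t \<ge> 1 \<Longrightarrow> integrable (measure_pmf (\<mu> t)) (\<lambda>x. \<rho> x \<one> powr p)"
    using assms(1) unfolding admissible_seq_def by blast+
  have "filterlim (\<lambda>t. r powr p * (real t * measure_pmf.prob (\<mu> t) (carrier G - {\<one>}))) at_top sequentially"
    using r top by (intro filterlim_tendsto_pos_mult_at_top[OF tendsto_const]) auto
  then show ?thesis
  proof (rule filterlim_at_top_mono)
    show "\<forall>\<^sub>F t in sequentially. r powr p * (real t * measure_pmf.prob (\<mu> t) (carrier G - {\<one>}))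
        \<le> real t * step_moment p (\<mu> t)"
      using eventually_ge_at_top[of 1]
    proof eventually_elim
      case (elim t)
      have "r powr p * measure_pmf.prob (\<mu> t) (carrier G - {\<one>})
          = measure_pmf.expectation (\<mu> t) (\<lambda>x. r powr p * indicator (carrier G - {\<one>}) x)"
        by simp
      also have "\<dots> \<le> measure_pmf.expectation (\<mu> t) (\<lambda>x. \<rho> x \<one> powr p)"
      proof (rule integral_mono)
        show "integrable (measure_pmf (\<mu> t)) (\<lambda>x. r powr p * indicator (carrier G - {\<one>}) x)"
          by (intro integrable_mult_right) (auto simp: less_top[symmetric])
        show "r powr p * indicator (carrier G - {\<one>}) x \<le> \<rho> x \<one> powr p" for x
          using r assms(2) by (auto simp: indicator_def intro!: powr_mono2)
      qed (rule adm(2)[OF elim])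
      finally have "real t * (r powr p * measure_pmf.prob (\<mu> t) (carrier G - {\<one>}))
          \<le> real t * measure_pmf.expectation (\<mu> t) (\<lambda>x. \<rho> x \<one> powr p)"
        by (intro mult_left_mono) auto
      then show ?case
        unfolding walk_pmf_1[OF adm(1)[OF elim]] by (simp add: mult_ac)
    qed
  qed
qed

text \<open>With \<open>E\<close> the mean displacement and \<open>D\<close> the argument of the denominator's logarithm,
  \<open>E powr q \<le> C * D\<close> gives the quotient \<open>1 / q\<close> up to the error \<open>ln C / (q * ln D)\<close>, which vanishes as \<open>D\<close>
  tends to infinity.\<close>

lemma beta_star_seq_le:
  assumes adm: "admissible_seq G \<rho> p \<mu>" and "0 \<le> p" and q: "1 \<le> q" and growth: "moment_growth p q"
  shows "beta_star_seq G \<rho> p \<mu> \<le> ereal (1 / q)"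
proof -
  define D where "D t = real t * step_moment p (\<mu> t)" for t
  define E where "E t = mean_displacement (\<mu> t) t" for t
  obtain C where C: "C > 0" and bound:
    "\<And>t \<mu>. 1 \<le> t \<Longrightarrow> symmetric_prob G \<mu> \<Longrightarrow> integrable (measure_pmf \<mu>) (\<lambda>x. \<rho> x \<one> powr p) \<Longrightarrow>
       mean_displacement \<mu> t powr q \<le> C * (real t * step_moment p \<mu>)"
    using mean_displacement_bound[OF q growth] by blast
  have ED: "E t powr q \<le> C * D t" if "t \<ge> 1" for t
    unfolding E_def D_def
    by (rule bound[OF that]) (use adm that in \<open>unfold admissible_seq_def, blast+\<close>)
  have D_top: "filterlim D at_top sequentially"
    unfolding D_def by (rule step_moment_at_top[OF adm \<open>0 \<le> p\<close>])
  then have lnD: "filterlim (\<lambda>t. ln (D t)) at_top sequentially"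
    by (rule filterlim_compose[OF ln_at_top])
  have "(\<lambda>t. 1 / q + (ln C / q) * inverse (ln (D t))) \<longlonglongrightarrow> 1 / q + (ln C / q) * 0"
    by (intro tendsto_intros tendsto_inverse_0_at_top lnD)
  then have lim: "(\<lambda>t. ereal (1 / q + (ln C / q) * inverse (ln (D t)))) \<longlonglongrightarrow> ereal (1 / q)"
    by simp
  have "\<forall>\<^sub>F t in sequentially. 1 \<le> t \<and> 1 < D t"
    using D_top by (intro eventually_conj eventually_ge_at_top) (auto simp: filterlim_at_top_dense)
  then have "\<forall>\<^sub>F t in sequentially. eln (E t) / eln (D t) \<le> ereal (1 / q + (ln C / q) * inverse (ln (D t)))"
  proof eventually_elim
    case (elim t)
    then have pos: "ln (D t) > 0" by simp
    show ?case
    proof (cases "E t > 0")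
      case True
      have "ln (E t powr q) \<le> ln (C * D t)"
        using ED[of t] elim C True by (intro ln_mono) auto
      then have "q * ln (E t) \<le> ln C + ln (D t)"
        using elim C True by (simp add: ln_powr ln_mult)
      then have "ln (E t) / ln (D t) \<le> 1 / q + (ln C / q) * inverse (ln (D t))"
        using q pos by (simp add: field_simps)
      then show ?thesis
        using True elim pos by (simp add: eln_def)
    next
      case False
      then show ?thesis
        using elim pos by (simp add: eln_def)
    qed
  qed
  then have "limsup (\<lambda>t. eln (E t) / eln (D t))
      \<le> limsup (\<lambda>t. ereal (1 / q + (ln C / q) * inverse (ln (D t))))"
    by (rule Limsup_mono)
  also have "\<dots> = ereal (1 / q)"
    using lim by (intro lim_imp_Limsup) auto
  finally show ?thesis
    by (simp add: beta_star_seq_def E_def D_def)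
qed

text \<open>If the displacement stays above a positive constant, then the numerators of the displacement
  exponent are bounded below while the denominators tend to infinity.\<close>

lemma beta_star_seq_nonneg:
  assumes adm: "admissible_seq G \<rho> p \<mu>" and "0 \<le> p"
    and "s > 0" "\<And>t. 1 \<le> t \<Longrightarrow> s \<le> mean_displacement (\<mu> t) t"
  shows "0 \<le> beta_star_seq G \<rho> p \<mu>"
proof -
  define D where "D t = real t * step_moment p (\<mu> t)" for t
  define E where "E t = mean_displacement (\<mu> t) t" for t
  have D_top: "filterlim D at_top sequentially"
    unfolding D_def by (rule step_moment_at_top[OF adm \<open>0 \<le> p\<close>])
  then have lnD: "filterlim (\<lambda>t. ln (D t)) at_top sequentially"
    by (rule filterlim_compose[OF ln_at_top])
  have "(\<lambda>t. ln s * inverse (ln (D t))) \<longlonglongrightarrow> ln s * 0"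
    by (intro tendsto_intros tendsto_inverse_0_at_top lnD)
  then have lim: "(\<lambda>t. ereal (ln s * inverse (ln (D t)))) \<longlonglongrightarrow> ereal 0"
    by simp
  have "0 = limsup (\<lambda>t. ereal (ln s * inverse (ln (D t))))"
    using lim_imp_Limsup[OF _ lim] by (simp add: zero_ereal_def)
  also have "\<dots> \<le> limsup (\<lambda>t. eln (E t) / eln (D t))"
  proof (rule Limsup_mono)
    have "\<forall>\<^sub>F t in sequentially. 1 \<le> t \<and> 1 < D t"
      using D_top by (intro eventually_conj eventually_ge_at_top) (auto simp: filterlim_at_top_dense)
    then show "\<forall>\<^sub>F t in sequentially. ereal (ln s * inverse (ln (D t))) \<le> eln (E t) / eln (D t)"
    proof eventually_elim
      case (elim t)
      then have pos: "ln (D t) > 0" by simp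
      have E: "s \<le> E t" using assms(4) elim by (simp add: E_def)
      then have "ln s * inverse (ln (D t)) \<le> ln (E t) * inverse (ln (D t))"
        using pos \<open>s > 0\<close> by (intro mult_right_mono ln_mono) auto
      then show ?case
        using E elim pos \<open>s > 0\<close> by (simp add: eln_def divide_inverse)
    qed
  qed
  finally show ?thesis
    by (simp add: beta_star_seq_def E_def D_def)
qed

text \<open>Conditionally on all steps but the first, the walk is at \<open>\<one>\<close> only if the first step takes one
  prescribed value.\<close>

lemma pmf_walk_le:
  assumes sym: "symmetric_prob G \<mu>" and le: "\<And>x. pmf \<mu> x \<le> d" and "t \<ge> 1"
  shows "pmf (walk_pmf G \<mu> t) \<one> \<le> d"
proof -
  have supp: "set_pmf \<mu> \<subseteq> carrier G" using sym unfolding symmetric_prob_def by blast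
  obtain n where t: "t = Suc n" using \<open>t \<ge> 1\<close> by (cases t) auto
  have "0 \<le> d" by (rule order_trans[OF pmf_nonneg le])
  have "ennreal (pmf (walk_pmf G \<mu> t) \<one>)
      = (\<integral>\<^sup>+gs. indicator {\<one>} (word_prod gs) \<partial>replicate_pmf (Suc n) \<mu>)"
    by (simp add: walk_pmf_def ennreal_pmf_map t indicator_vimage[of _ "{\<one>}"] del: replicate_pmf.simps)
  also have "\<dots> = (\<integral>\<^sup>+gs. \<integral>\<^sup>+g. indicator {\<one>} (word_prod (g # gs)) \<partial>\<mu> \<partial>replicate_pmf n \<mu>)"
    by (rule nn_integral_replicate_pmf_Cons)
  also have "\<dots> \<le> (\<integral>\<^sup>+gs. ennreal d \<partial>replicate_pmf n \<mu>)"
  proof (rule nn_integral_replicate_pmf_mono[OF supp])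
    fix gs assume "set gs \<subseteq> carrier G"
    then have w: "word_prod gs \<in> carrier G" by simp
    have "(\<integral>\<^sup>+g. indicator {\<one>} (word_prod (g # gs)) \<partial>\<mu>)
        \<le> (\<integral>\<^sup>+g. indicator {inv (word_prod gs)} g \<partial>\<mu>)"
    proof (rule nn_integral_mono_AE, unfold AE_measure_pmf_iff, rule ballI)
      fix g assume "g \<in> set_pmf \<mu>"
      then have "g \<in> carrier G" using supp by auto
      then show "indicator {\<one>} (word_prod (g # gs)) \<le> (indicator {inv (word_prod gs)} g :: ennreal)"
        using inv_equality[of g "word_prod gs"] w by (auto simp: indicator_def)
    qed
    also have "\<dots> = ennreal (pmf \<mu> (inv (word_prod gs)))"
      by (simp add: emeasure_pmf_single)
    also have "\<dots> \<le> ennreal d" by (rule ennreal_leI[OF le])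
    finally show "(\<integral>\<^sup>+g. indicator {\<one>} (word_prod (g # gs)) \<partial>\<mu>) \<le> ennreal d" .
  qed
  also have "\<dots> = ennreal d" by simp
  finally show ?thesis using \<open>0 \<le> d\<close> by simp
qed

text \<open>The mean displacement can vanish at some times, for example at even times if all steps are one
  involution. With steps uniform in \<open>{\<one>, g, inv g}\<close>, a set of at least two elements, the walk is
  away from \<open>\<one>\<close> with probability at least \<open>1 / 2\<close> at every time.\<close>

lemma exists_admissible_seq_beta_nonneg:
  assumes "0 \<le> p" and g: "g \<in> carrier G" "g \<noteq> \<one>"
  shows "\<exists>\<mu>. admissible_seq G \<rho> p \<mu> \<and> 0 \<le> beta_star_seq G \<rho> p \<mu>"
proof -
  obtain r where r: "r > 0" "\<And>x. x \<in> carrier G \<Longrightarrow> x \<noteq> \<one> \<Longrightarrow> r \<le> \<rho> x \<one>"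
    using uniformly_discrete by blast
  define S where "S = {\<one>, g, inv g}"
  define \<nu> where "\<nu> = pmf_of_set S"
  have S: "finite S" "S \<noteq> {}" "S \<subseteq> carrier G" using g by (auto simp: S_def)
  have "card {\<one>, g} \<le> card S" using S by (intro card_mono) (auto simp: S_def)
  then have card: "2 \<le> card S" using g by simp
  have supp: "set_pmf \<nu> = S" using S by (simp add: \<nu>_def)
  have half: "pmf \<nu> x \<le> 1 / 2" for x
    using S card by (auto simp: \<nu>_def indicator_def field_simps)
  have "inv x \<in> S \<longleftrightarrow> x \<in> S" if "x \<in> carrier G" for x
    using g that by (auto simp: S_def dest: inj_onD[OF inv_inj])
  then have sym: "symmetric_prob G \<nu>"
    using S by (simp add: symmetric_prob_def supp \<nu>_def indicator_def)
  have int: "integrable (measure_pmf \<nu>) f" for f :: "'a \<Rightarrow> real"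
    using S by (intro integrable_measure_pmf_finite) (simp add: supp)
  have away: "1 / 2 \<le> measure_pmf.prob (walk_pmf G \<nu> t) (carrier G - {\<one>})" if "t \<ge> 1" for t
  proof -
    have "set_pmf (walk_pmf G \<nu> t) \<subseteq> carrier G"
      using S supp by (auto simp: walk_pmf_def set_replicate_pmf intro!: word_prod_closed)
    then have "measure_pmf.prob (walk_pmf G \<nu> t) (carrier G) = 1"
      by (subst measure_pmf.prob_eq_1) (auto simp: AE_measure_pmf_iff)
    then have "measure_pmf.prob (walk_pmf G \<nu> t) (carrier G - {\<one>}) = 1 - pmf (walk_pmf G \<nu> t) \<one>"
      by (subst measure_pmf.finite_measure_Diff) (auto simp: measure_pmf_single)
    then show ?thesis
      using pmf_walk_le[OF sym half that] by simp
  qed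
  have adm: "admissible_seq G \<rho> p (\<lambda>_. \<nu>)"
    unfolding admissible_seq_def
  proof (intro conjI allI impI sym int)
    have "filterlim (\<lambda>t. real t * (1 / 2)) at_top sequentially"
      by (intro filterlim_at_top_mult_tendsto_pos[OF tendsto_const] filterlim_real_sequentially) simp
    then show "filterlim (\<lambda>t. real t * measure_pmf.prob \<nu> (carrier G - {\<one>})) at_top sequentially"
    proof (rule filterlim_at_top_mono, intro always_eventually allI mult_left_mono)
      show "1 / 2 \<le> measure_pmf.prob \<nu> (carrier G - {\<one>})"
        using away[of 1] unfolding walk_pmf_1[OF sym] by simp
    qed simp
  qed
  have "r * (1 / 2) \<le> mean_displacement \<nu> t" if "t \<ge> 1" for t
  proof -
    have "r * (1 / 2) \<le> r * measure_pmf.prob (walk_pmf G \<nu> t) (carrier G - {\<one>})"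
      using r away[OF that] by (intro mult_left_mono) auto
    also have "\<dots> = measure_pmf.expectation (walk_pmf G \<nu> t) (\<lambda>x. r * indicator (carrier G - {\<one>}) x)"
      by simp
    also have "\<dots> \<le> mean_displacement \<nu> t"
    proof (rule integral_mono)
      have fin: "finite (set_pmf (walk_pmf G \<nu> t))"
        using finite_lists_length_eq[OF S(1)] supp
        by (simp add: walk_pmf_def set_replicate_pmf lists_eq_set)
      show "integrable (measure_pmf (walk_pmf G \<nu> t)) (\<lambda>x. r * indicator (carrier G - {\<one>}) x)"
        "integrable (measure_pmf (walk_pmf G \<nu> t)) (\<lambda>x. \<rho> x \<one>)"
        using fin by (auto intro: integrable_measure_pmf_finite)
      show "r * indicator (carrier G - {\<one>}) x \<le> \<rho> x \<one>" for x
        using r by (auto simp: indicator_def)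
    qed
    finally show ?thesis .
  qed
  from beta_star_seq_nonneg[OF adm \<open>0 \<le> p\<close> _ this] r adm show ?thesis
    by auto
qed

text \<open>This sign is essential: a negative value would make the bound \<open>1 / (p * beta_star G \<rho> p)\<close> negative.\<close>

lemma beta_star_nonneg:
  assumes "0 \<le> p"
  shows "0 \<le> beta_star G \<rho> p"
proof (cases "\<exists>\<mu>. admissible_seq G \<rho> p \<mu>")
  case True
  then obtain \<mu> where adm: "admissible_seq G \<rho> p \<mu>" by blast
  have "\<exists>g\<in>carrier G. g \<noteq> \<one>"
  proof (rule ccontr)
    assume "\<not> ?thesis"
    then have "carrier G - {\<one>} = {}" by auto
    moreover have "filterlim (\<lambda>t. real t * measure_pmf.prob (\<mu> t) (carrier G - {\<one>})) at_top sequentially"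
      using adm unfolding admissible_seq_def by blast
    ultimately have "filterlim (\<lambda>t::nat. 0::real) at_top sequentially"
      by (simp only: measure_empty mult_zero_right)
    then show False
      using filterlim_at_top_dense[of "\<lambda>t::nat. 0::real" sequentially] by (auto dest: spec[of _ 0])
  qed
  then obtain \<mu>' where \<mu>': "admissible_seq G \<rho> p \<mu>'" "0 \<le> beta_star_seq G \<rho> p \<mu>'"
    using exists_admissible_seq_beta_nonneg[OF assms] by blast
  then have "beta_star_seq G \<rho> p \<mu>' \<le> beta_star G \<rho> p"
    unfolding beta_star_def Sup0_def by (auto intro!: Sup_upper)
  with \<mu>'(2) show ?thesis by (rule order_trans)
next
  case False
  then have "{beta_star_seq G \<rho> p \<mu> | \<mu>. admissible_seq G \<rho> p \<mu>} = {}" by blast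
  then show ?thesis unfolding beta_star_def Sup0_def by simp
qed

lemma beta_star_le:
  assumes "0 \<le> p" "1 \<le> q" "moment_growth p q"
  shows "beta_star G \<rho> p \<le> ereal (1 / q)"
  unfolding beta_star_def Sup0_def
  using beta_star_seq_le[OF _ assms] assms(2) by (auto intro!: Sup_least)

end

theorem theorem5p3:
  fixes G :: "('a, 'm) monoid_scheme" (structure)
    and \<rho> :: "'a \<Rightarrow> 'a \<Rightarrow> real"
    and p :: real
  assumes "group G"
    and "Metric_space (carrier G) \<rho>"
    and left_invariant: "\<And>g x y. \<lbrakk>g \<in> carrier G; x \<in> carrier G; y \<in> carrier G\<rbrakk> \<Longrightarrow>
           \<rho> (g \<otimes> x) (g \<otimes> y) = \<rho> x y"
    and finite_balls: "\<And>r. r \<ge> 0 \<Longrightarrow> finite {x \<in> carrier G. \<rho> x \<one> \<le> r}"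
    and "p \<in> {1..2}"
    and "smoothness_power_type TYPE('b::banach) p"
  shows "equivariant_compression TYPE('b) G \<rho> \<le> 1 / (ereal p * beta_star G \<rho> p)"
proof -
  have "proper_metric_group G \<rho>"
    using assms by (intro proper_metric_group.intro proper_metric_group_axioms.intro) auto
  then interpret proper_metric_group G \<rho> .
  have p: "1 \<le> p" "p \<le> 2" using assms(5) by auto
  define \<beta> where "\<beta> = beta_star G \<rho> p"
  have \<beta>_nonneg: "0 \<le> \<beta>" unfolding \<beta>_def using p by (intro beta_star_nonneg) simp
  have "\<beta> \<le> ereal (1 / 1)"
    unfolding \<beta>_def using p by (intro beta_star_le moment_growth_1) auto
  then obtain B where B: "\<beta> = ereal B" "0 \<le> B"
    using \<beta>_nonneg by (cases \<beta>) auto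
  have bound: "ereal \<alpha> \<le> 1 / (ereal p * \<beta>)"
    if \<alpha>: "\<alpha> \<ge> 0" and equi: "equivariant_map G \<psi>"
      and L: "L \<ge> 0" "\<forall>x\<in>carrier G. \<forall>y\<in>carrier G. norm (\<psi> x - \<psi> y) \<le> L * \<rho> x y"
      and c: "c > 0" "\<forall>x\<in>carrier G. \<forall>y\<in>carrier G. norm (\<psi> x - \<psi> y) \<ge> c * \<rho> x y powr \<alpha>"
    for \<alpha> L c and \<psi> :: "'a \<Rightarrow> 'b"
  proof -
    \<comment> \<open>Jensen's inequality needs an exponent of at least \<open>1\<close>.\<close>
    define q where "q = max 1 (p * \<alpha>)"
    have "moment_growth p (p * \<alpha>)"
      using L c by (intro moment_growth_compression[OF p assms(6) equi]) auto
    then have "moment_growth p q"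
      using moment_growth_1[OF p(1)] by (simp add: q_def max_def)
    then have "\<beta> \<le> ereal (1 / q)"
      unfolding \<beta>_def using p by (intro beta_star_le) (auto simp: q_def)
    then have "B \<le> 1 / q" using B by simp
    moreover have "q \<ge> 1" by (simp add: q_def)
    ultimately have "q * B \<le> 1" by (simp add: field_simps)
    moreover have "p * \<alpha> * B \<le> q * B"
      using B by (intro mult_right_mono) (auto simp: q_def)
    ultimately have le: "\<alpha> * (p * B) \<le> 1" by (simp add: mult_ac)
    show ?thesis
    proof (cases "B = 0")
      case True
      then show ?thesis using B by (simp add: divide_ereal_def flip: zero_ereal_def)
    next
      case False
      then have "\<alpha> \<le> 1 / (p * B)" using le p B by (simp add: field_simps)
      then show ?thesis using False p B by (simp add: one_ereal_def)
    qed
  qed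
  have "0 \<le> 1 / (ereal p * \<beta>)"
  proof (cases "B = 0")
    case True
    then show ?thesis using B by (simp add: divide_ereal_def flip: zero_ereal_def)
  next
    case False
    then show ?thesis using p B by (simp add: one_ereal_def zero_ereal_def)
  qed
  then show ?thesis
    unfolding equivariant_compression_def Sup0_def \<beta>_def[symmetric]
    using bound by (auto intro!: Sup_least)
qed

end
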